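(* Let $n\ge1$ be an integer, $0<p\le q<\infty$, $\alpha>0$, and let $\mu$ be a positive Borel measure on $\mathbb R^{n+1}_+$. Then the following conditions are equivalent: $1^o$. There is a constant $C$ such that $$\mu(\Delta_k)\le C\,\eta_k^{\,n\frac qp+\alpha q},\qquad k\ge1,$$ where $(\xi_k,\eta_k)$ is the center of $\Delta_k$. $2^o$. There is a continuous embedding $B^{q,p}_\alpha\hookrightarrow L^q(\mathbb R^{n+1}_+,d\mu)$.
   Context: $\mathbb R^{n+1}_+=\{(x,t):x\in\mathbb R^n,\ t>0\}$; $h(\mathbb R^{n+1}_+)$ is the space of harmonic functions on it. For $f$ measurable on $\mathbb R^{n+1}_+$, $M_p(f,t)=\|f(\cdot,t)\|_{L^p(\mathbb R^n,dx)}$. For $0<p,q<\infty$ and $\alpha>0$, $$B^{p,q}_\alpha=\Big\{f\in h(\mathbb R^{n+1}_+):\|f\|_{B^{p,q}_\alpha}=\Big(\int_0^\infty M_q(f,t)^p\,t^{\alpha p-1}\,dt\Big)^{1/p}<\infty\Big\}$$ (so in $B^{q,p}_\alpha$ the inner integral over $x$ is an $L^p$ norm and the outer exponent is $q$). $\{\Delta_k\}_{k\ge1}$ is a fixed Whitney decomposition of $\mathbb R^{n+1}_+$: closed cubes in $\mathbb R^{n+1}_+$ with sides parallel to the coordinate axes, with pairwise disjoint interiors, $\bigcup_k\Delta_k=\mathbb R^{n+1}_+$, ${\rm diam}\,\Delta_k\asymp{\rm dist}(\Delta_k,\partial\mathbb R^{n+1}_+)$ uniformly in $k$, and such that the cubes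 $\Delta_k^\ast$, with the same centers $(\xi_k,\eta_k)$ as $\Delta_k$ but enlarged $5/4$ times, form a finitely overlapping covering of $\mathbb R^{n+1}_+$ (so $\Delta_k^*\subset\mathbb R^{n+1}_+$ and $\sum_k\chi_{\Delta_k^\ast}\le C_n$), with $t\asymp\eta_k$ for $(x,t)\in\Delta_k^\ast$. *)

theory Defs
  imports "HOL-Analysis.Analysis"
begin

definition upper_half :: "('a::euclidean_space \<times> real) set" where
  "upper_half = {z. 0 < snd z}"

(* C^2 with vanishing Laplacian: f' z is the Frechet derivative of f at z, and f'' z u v is the
   second derivative of f at z, first in the direction u and then in the direction v. *)
definition harmonic_on :: "('a::euclidean_space \<Rightarrow> 'b::real_normed_vector) \<Rightarrow> 'a set \<Rightarrow> bool" where
  "harmonic_on f S \<longleftrightarrow> open S \<and>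
     (\<exists>f' f''.
        (\<forall>z\<in>S. (f has_derivative f' z) (at z)) \<and>
        (\<forall>z\<in>S. \<forall>u\<in>Basis. ((\<lambda>w. f' w u) has_derivative f'' z u) (at z)) \<and>
        (\<forall>u\<in>Basis. \<forall>v\<in>Basis. continuous_on S (\<lambda>z. f'' z u v)) \<and>
        (\<forall>z\<in>S. (\<Sum>u\<in>Basis. f'' z u u) = 0))"

(* Used for exponents a > 0 only. *)
definition ennpowr :: "ennreal \<Rightarrow> real \<Rightarrow> ennreal" where
  "ennpowr x a = (if x = top then top else ennreal (enn2real x powr a))"

(* A norm for p \<ge> 1 and a quasi-norm for 0 < p < 1; the value is infinite when f is not in L^p. *)
definition Lp_norm :: "real \<Rightarrow> 'a measure \<Rightarrow> ('a \<Rightarrow> 'b::real_normed_vector) \<Rightarrow> ennreal" where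
  "Lp_norm p M f = ennpowr (\<integral>\<^sup>+x. ennreal (norm (f x) powr p) \<partial>M) (1 / p)"

definition Lp_space :: "real \<Rightarrow> 'a measure \<Rightarrow> ('a \<Rightarrow> 'b::real_normed_vector) set" where
  "Lp_space p M = {f \<in> borel_measurable M. Lp_norm p M f < top}"

definition slice_norm :: "real \<Rightarrow> ('a::euclidean_space \<times> real \<Rightarrow> 'b::real_normed_vector) \<Rightarrow> real \<Rightarrow> ennreal" where
  "slice_norm p f t = Lp_norm p lborel (\<lambda>x. f (x, t))"

(* Order of the exponents: p is the outer one (in t) and q the inner one (in x). *)
definition B_norm ::
    "real \<Rightarrow> real \<Rightarrow> real \<Rightarrow> ('a::euclidean_space \<times> real \<Rightarrow> 'b::real_normed_vector) \<Rightarrow> ennreal" where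
  "B_norm p q \<alpha> f =
     ennpowr (\<integral>\<^sup>+t\<in>{0<..}. ennpowr (slice_norm q f t) p * ennreal (t powr (\<alpha> * p - 1)) \<partial>lborel) (1 / p)"

definition B_space ::
    "real \<Rightarrow> real \<Rightarrow> real \<Rightarrow> ('a::euclidean_space \<times> real \<Rightarrow> 'b::real_normed_vector) set" where
  "B_space p q \<alpha> = {f. harmonic_on f upper_half \<and> B_norm p q \<alpha> f < top}"

definition continuous_embedding ::
    "'f set \<Rightarrow> ('f \<Rightarrow> ennreal) \<Rightarrow> 'f set \<Rightarrow> ('f \<Rightarrow> ennreal) \<Rightarrow> bool" where
  "continuous_embedding X NX Y NY \<longleftrightarrow>
     X \<subseteq> Y \<and> (\<exists>C::real. 0 \<le> C \<and> (\<forall>f\<in>X. NY f \<le> ennreal C * NX f))"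

(* r is half of the side length. *)
definition cube :: "'a::euclidean_space \<Rightarrow> real \<Rightarrow> 'a set" where
  "cube c r = cbox (c - r *\<^sub>R One) (c + r *\<^sub>R One)"

(* The k-th cube has centre (xi k, eta k) and half side length r k. *)
definition whitney_decomposition ::
    "(nat \<Rightarrow> 'a::euclidean_space) \<Rightarrow> (nat \<Rightarrow> real) \<Rightarrow> (nat \<Rightarrow> real) \<Rightarrow> bool" where
  "whitney_decomposition \<xi> \<eta> r \<longleftrightarrow>
     (\<forall>k. 0 < r k) \<and>
     (\<forall>j k. j \<noteq> k \<longrightarrow> interior (cube (\<xi> j, \<eta> j) (r j)) \<inter> interior (cube (\<xi> k, \<eta> k) (r k)) = {}) \<and>
     (\<Union>k. cube (\<xi> k, \<eta> k) (r k)) = upper_half \<and>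
     (\<exists>a b. 0 < a \<and> 0 < b \<and>
        (\<forall>k. a * setdist (cube (\<xi> k, \<eta> k) (r k)) (frontier upper_half) \<le> diameter (cube (\<xi> k, \<eta> k) (r k)) \<and>
             diameter (cube (\<xi> k, \<eta> k) (r k)) \<le> b * setdist (cube (\<xi> k, \<eta> k) (r k)) (frontier upper_half))) \<and>
     (\<forall>k. cube (\<xi> k, \<eta> k) (5 / 4 * r k) \<subseteq> upper_half) \<and>
     (\<exists>N. \<forall>z. finite {k. z \<in> cube (\<xi> k, \<eta> k) (5 / 4 * r k)} \<and>
              card {k. z \<in> cube (\<xi> k, \<eta> k) (5 / 4 * r k)} \<le> N) \<and>
     (\<exists>a b. 0 < a \<and> 0 < b \<and>
        (\<forall>k x t. (x, t) \<in> cube (\<xi> k, \<eta> k) (5 / 4 * r k) \<longrightarrow> a * \<eta> k \<le> t \<and> t \<le> b * \<eta> k))"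

end

theory Submission
  imports Defs
begin

text \<open>
  Write \<open>n\<close> for the dimension of the \<open>x\<close>-space and \<open>m = q / p \<ge> 1\<close>.

  The measure condition implies the embedding because a harmonic function is controlled on a Whitney cube by
  its \<open>L\<^sup>p\<close> mean over the enlarged cube, for every \<open>p > 0\<close>
  (\<open>harmonic_norm_powr_le_ball_average\<close>).  For \<open>p = 1\<close> this follows from a mean value identity with a
  smooth radial weight (\<open>harmonic_bump_mean_value\<close>), for \<open>p \<ge> 1\<close> from there by a power mean inequality,
  and for \<open>p < 1\<close> by an extremal argument of Hardy and Littlewood.  Raising the estimate to the power \<open>m\<close> and
  moving that power inside the integral over \<open>t\<close> gives, on the \<open>k\<close>-th cube,
  \<open>|f| powr q \<le> C * \<eta> k powr (- n * m - 1) * (\<integral> A k t powr m dt)\<close>, where \<open>A k t\<close> is the integral of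
  \<open>|f| powr p\<close> over the slice of the enlarged cube at height \<open>t\<close>.  The measure of the cube turns the factor
  into \<open>\<eta> k powr (\<alpha> * q - 1)\<close>, the weight of the norm.  The sum over \<open>k\<close> is harmless since
  \<open>\<Sum>k. A k t powr m \<le> (\<Sum>k. A k t) powr m\<close>, which needs \<open>p \<le> q\<close>, and since the enlarged cubes overlap
  finitely often.

  For the converse the embedding is tested on harmonic functions peaked at a cube
  (\<open>ex_peaked_harmonic\<close>).  They are translates of Kelvin transforms of the harmonic polynomials
  \<open>Re ((t + \<i> x\<^sub>j) ^ l)\<close> with \<open>l\<close> large, so they decay as fast as desired, which makes their norm finite for small \<open>p\<close> and
  large \<open>\<alpha>\<close> too, and have no zero on the cube if the pole is far enough below it.
\<close>

section \<open>A weighted mean value identity for harmonic functions\<close>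

text \<open>The box has room for the unit ball and for its translate by \<open>- c\<close>, so both integrals are integrals over the
  whole space.\<close>
lemma integral_translation_of_supported_in_ball:
  fixes g :: "'a::euclidean_space \<Rightarrow> 'b::euclidean_space"
  assumes g: "continuous_on UNIV g" and zero: "\<And>y. norm y \<ge> 1 \<Longrightarrow> g y = 0" and c: "norm c \<le> 1"
  defines "W \<equiv> cbox (- (2 *\<^sub>R One)) (2 *\<^sub>R One) :: 'a set"
  shows "integral W (\<lambda>y. g (y + c)) = integral W g"
proof -
  have W: "y \<in> W" if "norm y \<le> 2" for y
    using that Basis_le_norm[of _ y] unfolding W_def mem_box
    by (fastforce simp: inner_simps abs_le_iff)
  have out: "g y = 0" if "y \<notin> W" for y
    using W[of y] that zero[of y] by (cases "norm y \<le> 2") auto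
  have out': "g (y + c) = 0" if "y \<notin> W" for y
  proof (rule zero)
    have "norm y > 2" using W[of y] that by (cases "norm y \<le> 2") auto
    then show "1 \<le> norm (y + c)" using c norm_triangle_ineq2[of y "-c"] by simp
  qed
  have "(g has_integral integral W g) W"
    unfolding W_def by (intro integrable_integral integrable_continuous continuous_on_subset[OF g]) auto
  then have "((\<lambda>x. g (1 *\<^sub>R x + c)) has_integral (integral W g /\<^sub>R 1 ^ DIM('a)))
      (cbox ((- (2 *\<^sub>R One) - c) /\<^sub>R 1) ((2 *\<^sub>R One - c) /\<^sub>R 1))"
    unfolding W_def by (rule has_integral_affinity') simp
  then have "((\<lambda>x. g (x + c)) has_integral integral W g) (cbox (- (2 *\<^sub>R One) - c) (2 *\<^sub>R One - c))"
    by simp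
  then have 1: "((\<lambda>x. g (x + c)) has_integral integral W g) UNIV"
  proof (rule has_integral_on_superset)
    fix x assume "x \<notin> cbox (- (2 *\<^sub>R One) - c) (2 *\<^sub>R One - c)"
    then have "x + c \<notin> W" unfolding W_def by (auto simp: mem_box inner_simps algebra_simps)
    then show "g (x + c) = 0" by (rule out)
  qed auto
  have "((\<lambda>x. g (x + c)) has_integral integral W (\<lambda>y. g (y + c))) W"
    unfolding W_def
    by (intro integrable_integral integrable_continuous continuous_on_compose2[OF g] continuous_intros) auto
  then have 2: "((\<lambda>x. g (x + c)) has_integral integral W (\<lambda>y. g (y + c))) UNIV"
    by (rule has_integral_on_superset) (auto simp: out')
  show ?thesis using has_integral_unique[OF 1 2] by simp
qed

text \<open>The divergence theorem for compactly supported functions: the integral of a translate of \<open>g\<close> along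
  \<open>u\<close> does not depend on the length of the translation, and its derivative at length 0 is the integral of
  the directional derivative.\<close>
lemma integral_directional_derivative_eq_0:
  fixes g :: "'a::euclidean_space \<Rightarrow> 'b::euclidean_space"
  assumes g: "\<And>y. (g has_derivative g' y) (at y)"
    and g': "continuous_on UNIV (\<lambda>y. g' y u)"
    and zero: "\<And>y. norm y \<ge> 1 \<Longrightarrow> g y = 0" and u: "norm u \<le> 1"
  shows "integral (cbox (- (2 *\<^sub>R One)) (2 *\<^sub>R One)) (\<lambda>y. g' y u) = 0"
proof -
  let ?W = "cbox (- (2 *\<^sub>R One)) (2 *\<^sub>R One) :: 'a set"
  have cont: "continuous_on UNIV g"
    using g by (auto simp: continuous_on_eq_continuous_within intro: has_derivative_continuous)
  have "((\<lambda>h. integral ?W (\<lambda>y. g (y + h *\<^sub>R u))) has_vector_derivative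
          integral ?W (\<lambda>y. g' (y + 0 *\<^sub>R u) u)) (at 0 within {0..1})"
  proof (rule leibniz_rule_vector_derivative)
    fix h :: real and y :: 'a
    have "((\<lambda>h. g (y + h *\<^sub>R u)) has_derivative (\<lambda>k. g' (y + h *\<^sub>R u) (k *\<^sub>R u))) (at h within {0..1})"
      by (rule has_derivative_compose[OF _ g, where f="\<lambda>h. y + h *\<^sub>R u"]) (auto intro!: derivative_eq_intros)
    then show "((\<lambda>h. g (y + h *\<^sub>R u)) has_vector_derivative g' (y + h *\<^sub>R u) u) (at h within {0..1})"
      using has_derivative_bounded_linear[OF g]
      by (simp add: has_vector_derivative_def linear_simps)
  next
    fix h :: real
    show "(\<lambda>y. g (y + h *\<^sub>R u)) integrable_on ?W"
      by (intro integrable_continuous continuous_on_compose2[OF cont] continuous_intros) auto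
  next
    show "continuous_on ({0..1} \<times> ?W) (\<lambda>(h, y). g' (y + h *\<^sub>R u) u)"
      unfolding case_prod_unfold
      by (intro continuous_on_compose2[OF g'] continuous_intros) auto
  qed auto
  then have 1: "((\<lambda>h. integral ?W (\<lambda>y. g (y + h *\<^sub>R u))) has_vector_derivative
          integral ?W (\<lambda>y. g' y u)) (at 0 within {0..1})" by simp
  have "((\<lambda>h. integral ?W (\<lambda>y. g (y + h *\<^sub>R u))) has_vector_derivative 0) (at (0::real) within {0..1})"
  proof (rule has_vector_derivative_transform[where f="\<lambda>h. integral ?W g"])
    fix h :: real assume "h \<in> {0..1}"
    then have "norm (h *\<^sub>R u) \<le> 1" using u by (simp add: mult_le_one)
    then show "integral ?W (\<lambda>y. g (y + h *\<^sub>R u)) = integral ?W g"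
      using integral_translation_of_supported_in_ball[OF cont zero] by blast
  qed auto
  then show ?thesis using vector_derivative_unique_within_closed_interval[of 0 1 0, OF _ _ 1[unfolded cbox_interval[symmetric]]]
    by (simp add: cbox_interval)
qed

lemma has_field_derivative_max_0_power:
  fixes x :: real
  assumes "n \<ge> 1"
  shows "((\<lambda>x. max 0 x ^ Suc n) has_field_derivative real (Suc n) * max 0 x ^ n) (at x)"
proof -
  consider "x < 0" | "x > 0" | "x = 0" by linarith
  then show ?thesis
  proof cases
    case 1
    have "((\<lambda>x. 0) has_field_derivative real (Suc n) * max 0 x ^ n) (at x)"
      using 1 assms by (cases n) auto
    then show ?thesis
      by (rule has_field_derivative_transform_within[where d="-x"]) (use 1 in \<open>auto simp: dist_real_def\<close>)
  next
    case 2
    have "((\<lambda>x. x ^ Suc n) has_field_derivative real (Suc n) * max 0 x ^ n) (at x)"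
      using 2 DERIV_pow[of "Suc n" x UNIV] by simp
    then show ?thesis
      by (rule has_field_derivative_transform_within[where d="x"]) (use 2 in \<open>auto simp: dist_real_def max_def\<close>)
  next
    case 3
    have "(\<lambda>h. (max 0 (0 + h) ^ Suc n - max 0 0 ^ Suc n) / h) \<midarrow>0\<rightarrow> (0::real)"
    proof (rule Lim_null_comparison)
      show "\<forall>\<^sub>F h in at 0. norm ((max 0 (0 + h) ^ Suc n - max 0 0 ^ Suc n) / h) \<le> \<bar>h::real\<bar> ^ n"
        by (auto simp: max_def abs_mult power_abs intro!: always_eventually)
      have "(\<lambda>h::real. \<bar>h\<bar> ^ n) \<midarrow>0\<rightarrow> \<bar>0\<bar> ^ n" by (intro tendsto_intros)
      then show "(\<lambda>h::real. \<bar>h\<bar> ^ n) \<midarrow>0\<rightarrow> 0" using assms by (simp add: power_0_left split: if_splits)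
    qed
    then show ?thesis using 3 assms by (simp add: DERIV_def power_0_left)
  qed
qed

text \<open>A radial cut-off together with a potential: the gradient of \<open>bump_potential\<close> is \<open>bump y *\<^sub>R y\<close>.
  Powers of a positive part are as smooth as the differentiations require, and their derivatives are
  explicit.\<close>
definition bump :: "'a::euclidean_space \<Rightarrow> real" where
  "bump y = max 0 (1 - y \<bullet> y) ^ 3"

definition bump_potential :: "'a::euclidean_space \<Rightarrow> real" where
  "bump_potential y = - (max 0 (1 - y \<bullet> y) ^ 4 / 8)"

lemma bump_potential_has_derivative:
  "(bump_potential has_derivative (\<lambda>v. bump y * (y \<bullet> v))) (at y)"
proof -
  have "((\<lambda>x::real. max 0 x ^ 4) has_derivative (\<lambda>h. h * (4 * max 0 x ^ 3))) (at x)" for x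
    using has_field_derivative_max_0_power[of 3 x] unfolding has_field_derivative_def
    by (auto simp: eval_nat_numeral elim!: has_derivative_eq_rhs)
  note d = has_derivative_compose[OF _ this, of "\<lambda>y. 1 - y \<bullet> y"]
  show ?thesis unfolding bump_potential_def[abs_def] bump_def
    by (rule has_derivative_eq_rhs, (rule derivative_intros d)+) (auto simp: fun_eq_iff inner_commute)
qed

lemma continuous_on_bump [continuous_intros]:
  "continuous_on S f \<Longrightarrow> continuous_on S (\<lambda>x. bump (f x))"
  unfolding bump_def by (intro continuous_intros)

lemma continuous_on_bump_potential [continuous_intros]:
  "continuous_on S f \<Longrightarrow> continuous_on S (\<lambda>x. bump_potential (f x))"
  unfolding bump_potential_def by (intro continuous_intros) auto

lemma bump_eq_0: "norm y \<ge> 1 \<Longrightarrow> bump y = 0"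
  and bump_potential_eq_0: "norm y \<ge> 1 \<Longrightarrow> bump_potential y = 0"
  and bump_nonneg: "bump y \<ge> 0" and bump_le_1: "bump y \<le> 1"
proof -
  have "y \<bullet> y \<ge> 1" if "norm y \<ge> 1"
    using that by (metis dot_square_norm one_le_power)
  then show "norm y \<ge> 1 \<Longrightarrow> bump y = 0" "norm y \<ge> 1 \<Longrightarrow> bump_potential y = 0"
    by (auto simp: bump_def bump_potential_def)
  show "bump y \<ge> 0" "bump y \<le> 1" by (auto simp: bump_def intro!: power_le_one)
qed

text \<open>A cut-off \<open>k\<close> makes a function continuous whose behaviour is controlled on \<open>S\<close> only, provided
  that \<open>k\<close> vanishes on a closed set covering the rest.\<close>
lemma continuous_on_mult_supported:
  fixes F :: "'a::topological_space \<Rightarrow> 'b::real_normed_vector"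
  assumes k: "continuous_on K k" and S: "closed S" and F: "continuous_on (K \<inter> S) F"
    and T: "closed T" and ST: "K \<subseteq> S \<union> T" and zero: "\<And>x. x \<in> T \<Longrightarrow> k x = (0::real)"
  shows "continuous_on K (\<lambda>x. k x *\<^sub>R F x)"
proof -
  have "continuous_on (K \<inter> S) (\<lambda>x. k x *\<^sub>R F x)"
    by (intro continuous_intros F continuous_on_subset[OF k]) auto
  moreover have "continuous_on (K \<inter> T) (\<lambda>x. k x *\<^sub>R F x)"
    by (rule continuous_on_eq[of _ "\<lambda>x. 0"]) (auto simp: zero)
  moreover have "(K \<inter> S) \<union> (K \<inter> T) = K" using ST by auto
  moreover have "closedin (top_of_set K) (K \<inter> S)" "closedin (top_of_set K) (K \<inter> T)"
    using S T by (auto intro!: closedin_closed_Int)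
  ultimately show ?thesis
    using continuous_on_cases_local[of "K \<inter> S" "K \<inter> T" "\<lambda>x. k x *\<^sub>R F x" "\<lambda>x. k x *\<^sub>R F x" "\<lambda>_. True"]
    by simp
qed

lemma integral_bump_pos: "integral (cbox (- (2 *\<^sub>R One)) (2 *\<^sub>R One :: 'a::euclidean_space)) bump > 0"
proof -
  let ?W = "cbox (- (2 *\<^sub>R One)) (2 *\<^sub>R One) :: 'a set"
  have c: "continuous_on ?W (bump :: 'a \<Rightarrow> real)" by (rule continuous_on_bump[OF continuous_on_id]) 
  have "integral ?W bump \<noteq> 0"
  proof
    assume "integral ?W bump = 0"
    then have "((bump :: 'a \<Rightarrow> real) has_integral 0) ?W"
      using integrable_integral[OF integrable_continuous[OF c]] by simp
    then have "bump (0::'a) = 0"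
      by (rule has_integral_0_cbox_imp_0[OF c bump_nonneg]) (auto simp: mem_box box_ne_empty)
    then show False by (simp add: bump_def)
  qed
  moreover have "integral ?W bump \<ge> 0"
    by (intro Henstock_Kurzweil_Integration.integral_nonneg integrable_continuous c bump_nonneg)
  ultimately show ?thesis by simp
qed

text \<open>The weighted mean \<open>F \<sigma>\<close> of \<open>y \<mapsto> f (z + \<sigma> y)\<close> against \<open>bump\<close> is constant in the dilation parameter
  \<open>\<sigma>\<close>.  Its derivative is the integral of \<open>bump y *\<^sub>R D f (z + \<sigma> y) y\<close>; since \<open>bump y *\<^sub>R y\<close> is
  the gradient of \<open>bump_potential\<close>, this integrand is the divergence of the compactly supported field
  \<open>bump_potential y *\<^sub>R \<nabla>f (z + \<sigma> y)\<close> minus a multiple of the Laplacian of \<open>f\<close>.  Smooth weights replace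
  surface integrals over spheres.\<close>
lemma harmonic_bump_mean_value:
  fixes f :: "'a::euclidean_space \<Rightarrow> 'b::euclidean_space"
  assumes f: "harmonic_on f S" and S: "cball z s \<subseteq> S" and s: "0 \<le> s"
  defines "W \<equiv> cbox (- (2 *\<^sub>R One)) (2 *\<^sub>R One) :: 'a set"
  shows "integral W (\<lambda>y. bump y *\<^sub>R f (z + s *\<^sub>R y)) = integral W bump *\<^sub>R f z"
proof -
  obtain f' f'' where f1: "\<And>w. w \<in> S \<Longrightarrow> (f has_derivative f' w) (at w)"
    and f2: "\<And>w u. w \<in> S \<Longrightarrow> u \<in> Basis \<Longrightarrow> ((\<lambda>w. f' w u) has_derivative f'' w u) (at w)"
    and f3: "\<And>u v. u \<in> Basis \<Longrightarrow> v \<in> Basis \<Longrightarrow> continuous_on S (\<lambda>z. f'' z u v)"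
    and f4: "\<And>w. w \<in> S \<Longrightarrow> (\<Sum>u\<in>Basis. f'' w u u) = 0"
    using f unfolding harmonic_on_def by blast
  have c0: "continuous_on S f"
    by (auto simp: continuous_on_eq_continuous_within intro!: has_derivative_continuous has_derivative_at_withinI[OF f1])
  have c1: "continuous_on S (\<lambda>w. f' w u)" if "u \<in> Basis" for u
    using that by (auto simp: continuous_on_eq_continuous_within intro!: has_derivative_continuous has_derivative_at_withinI[OF f2])
  have inS: "z + \<sigma> *\<^sub>R y \<in> S" if "norm y \<le> 1" "\<sigma> \<in> {0..s}" for y \<sigma>
  proof -
    have "norm (\<sigma> *\<^sub>R y) \<le> s" using that mult_mono[of \<sigma> s "norm y" 1] by simp
    then show ?thesis using S by (auto simp: dist_norm)
  qed
  have lin: "f' w y = (\<Sum>b\<in>Basis. (y \<bullet> b) *\<^sub>R f' w b)" if "w \<in> S" for w y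
  proof -
    interpret bounded_linear "f' w" using f1[OF that] by (rule has_derivative_bounded_linear)
    have "f' w (\<Sum>b\<in>Basis. (y \<bullet> b) *\<^sub>R b) = (\<Sum>b\<in>Basis. (y \<bullet> b) *\<^sub>R f' w b)"
      by (simp add: sum scaleR)
    then show ?thesis by (simp add: euclidean_representation)
  qed
  have cl: "closed {y::'a. norm y \<le> 1}" "closed {y::'a. 1 \<le> norm y}"
    by (intro closed_Collect_le continuous_intros)+
  have cl2: "closed {y::real \<times> 'a. norm (snd y) \<le> 1}" "closed {y::real \<times> 'a. 1 \<le> norm (snd y)}"
    by (intro closed_Collect_le continuous_intros)+
  define F where "F = (\<lambda>\<sigma>. integral W (\<lambda>y. bump y *\<^sub>R f (z + \<sigma> *\<^sub>R y)))"
  have F': "(F has_vector_derivative integral W (\<lambda>y. bump y *\<^sub>R f' (z + \<sigma> *\<^sub>R y) y)) (at \<sigma> within {0..s})"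
    if \<sigma>: "\<sigma> \<in> {0..s}" for \<sigma>
    unfolding F_def W_def
  proof (rule leibniz_rule_vector_derivative)
    fix \<tau> :: real and y :: 'a
    assume \<tau>: "\<tau> \<in> {0..s}"
    show "((\<lambda>\<tau>. bump y *\<^sub>R f (z + \<tau> *\<^sub>R y)) has_vector_derivative bump y *\<^sub>R f' (z + \<tau> *\<^sub>R y) y) (at \<tau> within {0..s})"
    proof (cases "norm y \<le> 1")
      case True
      have "((\<lambda>h. f (z + h *\<^sub>R y)) has_derivative (\<lambda>k. f' (z + \<tau> *\<^sub>R y) (k *\<^sub>R y))) (at \<tau> within {0..s})"
      proof (rule has_derivative_compose[where f="\<lambda>h. z + h *\<^sub>R y" and g=f])
        show "((\<lambda>h. z + h *\<^sub>R y) has_derivative (\<lambda>k. k *\<^sub>R y)) (at \<tau> within {0..s})"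
          by (auto intro!: derivative_eq_intros)
      qed (rule f1[OF inS[OF True \<tau>]])
      then have "((\<lambda>\<tau>. f (z + \<tau> *\<^sub>R y)) has_vector_derivative f' (z + \<tau> *\<^sub>R y) y) (at \<tau> within {0..s})"
        unfolding has_vector_derivative_def
        by (simp only: linear_scale[OF bounded_linear.linear[OF has_derivative_bounded_linear[OF f1[OF inS[OF True \<tau>]]]]])
      then show ?thesis
        unfolding has_vector_derivative_def
        by (rule has_derivative_eq_rhs[OF has_derivative_scaleR_right]) (simp add: fun_eq_iff)
    qed (simp add: bump_eq_0)
  next
    fix \<tau> :: real
    assume \<tau>: "\<tau> \<in> {0..s}"
    have "continuous_on (cbox (- (2 *\<^sub>R One)) (2 *\<^sub>R One)) (\<lambda>y. bump y *\<^sub>R f (z + \<tau> *\<^sub>R y))"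
      by (rule continuous_on_mult_supported[OF _ cl(1) _ cl(2)])
        (use \<tau> in \<open>auto intro!: continuous_intros continuous_on_compose2[OF c0] inS bump_eq_0\<close>)
    then show "(\<lambda>y. bump y *\<^sub>R f (z + \<tau> *\<^sub>R y)) integrable_on cbox (- (2 *\<^sub>R One)) (2 *\<^sub>R One)"
      by (rule integrable_continuous)
  next
    have "continuous_on ({0..s} \<times> cbox (- (2 *\<^sub>R One)) (2 *\<^sub>R One)) (\<lambda>x. bump (snd x) *\<^sub>R f' (z + fst x *\<^sub>R snd x) (snd x))"
    proof (rule continuous_on_mult_supported[OF _ cl2(1) _ cl2(2)])
      have "continuous_on ({0..s} \<times> cbox (- (2 *\<^sub>R One)) (2 *\<^sub>R One) \<inter> {y. norm (snd y) \<le> 1})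
              (\<lambda>x. \<Sum>b\<in>Basis. (snd x \<bullet> b) *\<^sub>R f' (z + fst x *\<^sub>R snd x) b)"
        by (auto intro!: continuous_intros continuous_on_compose2[OF c1] inS)
      then show "continuous_on ({0..s} \<times> cbox (- (2 *\<^sub>R One)) (2 *\<^sub>R One) \<inter> {y. norm (snd y) \<le> 1})
              (\<lambda>x. f' (z + fst x *\<^sub>R snd x) (snd x))"
        by (rule continuous_on_eq) (auto intro!: lin[symmetric] inS)
    qed (auto intro!: continuous_intros bump_eq_0)
    then show "continuous_on ({0..s} \<times> cbox (- (2 *\<^sub>R One)) (2 *\<^sub>R One)) (\<lambda>(\<tau>, y). bump y *\<^sub>R f' (z + \<tau> *\<^sub>R y) y)"
      by (simp add: case_prod_unfold)
  qed (use \<sigma> in auto)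
  have zero: "integral W (\<lambda>y. bump y *\<^sub>R f' (z + \<sigma> *\<^sub>R y) y) = 0" if \<sigma>: "\<sigma> \<in> {0..s}" for \<sigma>
  proof -
    \<comment> \<open>\<open>G b\<close> is the derivative of \<open>y \<mapsto> bump_potential y *\<^sub>R \<partial>\<^sub>b f (z + \<sigma> y)\<close>, with value 0 off the unit ball.\<close>
    define G where "G b y v = bump_potential y *\<^sub>R f'' (z + \<sigma> *\<^sub>R y) b (\<sigma> *\<^sub>R v)
        + (bump y * (y \<bullet> v)) *\<^sub>R f' (z + \<sigma> *\<^sub>R y) b" for b y v
    have f''lin: "f'' (z + \<sigma> *\<^sub>R y) b (\<sigma> *\<^sub>R v) = \<sigma> *\<^sub>R f'' (z + \<sigma> *\<^sub>R y) b v"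
      if "norm y \<le> 1" "b \<in> Basis" for y b v
      using has_derivative_bounded_linear[OF f2[OF inS[OF that(1) \<sigma>] that(2)]] by (simp add: linear_simps)
    have Gc: "continuous_on UNIV (\<lambda>y. G b y b)" if b: "b \<in> Basis" for b
      unfolding G_def
    proof (rule continuous_on_add)
      show "continuous_on UNIV (\<lambda>y. bump_potential y *\<^sub>R f'' (z + \<sigma> *\<^sub>R y) b (\<sigma> *\<^sub>R b))"
      proof (rule continuous_on_mult_supported[OF _ cl(1) _ cl(2)])
        have "continuous_on (UNIV \<inter> {y. norm y \<le> 1}) (\<lambda>y. \<sigma> *\<^sub>R f'' (z + \<sigma> *\<^sub>R y) b b)"
          using \<sigma> b by (auto intro!: continuous_intros continuous_on_compose2[OF f3] inS)
        then show "continuous_on (UNIV \<inter> {y. norm y \<le> 1}) (\<lambda>y. f'' (z + \<sigma> *\<^sub>R y) b (\<sigma> *\<^sub>R b))"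
          by (rule continuous_on_eq) (use b in \<open>simp add: f''lin\<close>)
      qed (auto intro!: continuous_intros bump_potential_eq_0)
      show "continuous_on UNIV (\<lambda>y. (bump y * (y \<bullet> b)) *\<^sub>R f' (z + \<sigma> *\<^sub>R y) b)"
        by (rule continuous_on_mult_supported[OF _ cl(1) _ cl(2)])
          (use \<sigma> b in \<open>auto intro!: continuous_intros continuous_on_compose2[OF c1] inS simp: bump_eq_0\<close>)
    qed
    have Gd: "((\<lambda>y. bump_potential y *\<^sub>R f' (z + \<sigma> *\<^sub>R y) b) has_derivative G b y) (at y)" if b: "b \<in> Basis" for b y
    proof (cases "norm y \<le> 1")
      case True
      have "((\<lambda>y. f' (z + \<sigma> *\<^sub>R y) b) has_derivative (\<lambda>v. f'' (z + \<sigma> *\<^sub>R y) b (\<sigma> *\<^sub>R v))) (at y)"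
      proof (rule has_derivative_compose[where f="\<lambda>y. z + \<sigma> *\<^sub>R y" and g="\<lambda>w. f' w b"])
        show "((\<lambda>y. z + \<sigma> *\<^sub>R y) has_derivative (\<lambda>v. \<sigma> *\<^sub>R v)) (at y)"
          by (auto intro!: derivative_eq_intros)
      qed (rule f2[OF inS[OF True \<sigma>] b])
      from has_derivative_scaleR[OF bump_potential_has_derivative this]
      show ?thesis unfolding G_def[abs_def] .
    next
      case False
      have G0: "G b y = (\<lambda>v. 0)" using False by (auto simp: G_def bump_eq_0 bump_potential_eq_0)
      show ?thesis unfolding G0
      proof (rule has_derivative_transform_within_open[where f="\<lambda>y. 0"])
        show "open {y::'a. 1 < norm y}" by (intro open_Collect_less continuous_intros)
      qed (use False in \<open>auto simp: bump_potential_eq_0\<close>)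
    qed
    have int0: "integral W (\<lambda>y. G b y b) = 0" if "b \<in> Basis" for b
      unfolding W_def
      by (rule integral_directional_derivative_eq_0[OF Gd Gc])
        (use that in \<open>auto simp: bump_potential_eq_0\<close>)
    have "(\<Sum>b\<in>Basis. G b y b) = bump y *\<^sub>R f' (z + \<sigma> *\<^sub>R y) y" for y
    proof (cases "norm y \<le> 1")
      case True
      have "(\<Sum>b\<in>Basis. G b y b) = (\<Sum>b\<in>Basis. bump_potential y *\<^sub>R \<sigma> *\<^sub>R f'' (z + \<sigma> *\<^sub>R y) b b)
          + (\<Sum>b\<in>Basis. bump y *\<^sub>R (y \<bullet> b) *\<^sub>R f' (z + \<sigma> *\<^sub>R y) b)"
        by (simp add: G_def sum.distrib f''lin True)
      also have "\<dots> = bump y *\<^sub>R f' (z + \<sigma> *\<^sub>R y) y"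
        unfolding scaleR_right.sum[symmetric] f4[OF inS[OF True \<sigma>]] lin[OF inS[OF True \<sigma>], of y] by simp
      finally show ?thesis .
    qed (simp add: G_def bump_eq_0 bump_potential_eq_0)
    then have "integral W (\<lambda>y. bump y *\<^sub>R f' (z + \<sigma> *\<^sub>R y) y) = integral W (\<lambda>y. \<Sum>b\<in>Basis. G b y b)"
      by simp
    also have "\<dots> = (\<Sum>b\<in>Basis. integral W (\<lambda>y. G b y b))"
      unfolding W_def by (intro integral_sum finite_Basis integrable_continuous continuous_on_subset[OF Gc]) auto
    also have "\<dots> = 0" by (simp add: int0)
    finally show ?thesis .
  qed
  obtain c where c: "\<And>\<sigma>. \<sigma> \<in> {0..s} \<Longrightarrow> F \<sigma> = c"
    using has_vector_derivative_zero_constant[of "{0..s}" F] F' zero by auto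
  have "F s = F 0" using c s by simp
  moreover have "((\<lambda>y. bump y *\<^sub>R f z) has_integral integral W bump *\<^sub>R f z) W"
    unfolding W_def
    by (intro has_integral_scaleR_left integrable_integral integrable_continuous continuous_on_bump[OF continuous_on_id])
  ultimately show ?thesis
    by (simp add: F_def integral_unique)
qed

section \<open>Powers of extended nonnegative reals and power means\<close>

lemma ennpowr_ennreal: "x \<ge> 0 \<Longrightarrow> ennpowr (ennreal x) a = ennreal (x powr a)"
  by (simp add: ennpowr_def)

lemma ennpowr_top [simp]: "ennpowr top a = top"
  by (simp add: ennpowr_def)

lemma ennpowr_0 [simp]: "ennpowr 0 a = 0"
  by (simp add: ennpowr_def)

lemma ennpowr_1 [simp]: "ennpowr x 1 = x"
  by (cases x) (auto simp: ennpowr_ennreal)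

lemma ennpowr_eq_top_iff [simp]: "ennpowr x a = top \<longleftrightarrow> x = top"
  by (simp add: ennpowr_def)

lemma ennpowr_mono: "x \<le> y \<Longrightarrow> 0 \<le> a \<Longrightarrow> ennpowr x a \<le> ennpowr y a"
  by (cases x; cases y) (auto simp: ennpowr_ennreal intro!: ennreal_leI powr_mono2 simp: top_unique)

lemma ennpowr_mult: "ennpowr (x * y) a = ennpowr x a * ennpowr y a"
proof (cases x; cases y)
  fix r s assume "0 \<le> r" "x = ennreal r" "0 \<le> s" "y = ennreal s"
  then show ?thesis by (simp add: ennpowr_ennreal powr_mult flip: ennreal_mult)
next
  fix r assume "0 \<le> r" "x = ennreal r" "y = top"
  then show ?thesis by (cases "r = 0") (auto simp: ennpowr_ennreal ennreal_mult_top)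
next
  fix r assume "0 \<le> r" "y = ennreal r" "x = top"
  then show ?thesis by (cases "r = 0") (auto simp: ennpowr_ennreal ennreal_top_mult)
qed simp

lemma ennpowr_ennpowr: "ennpowr (ennpowr x a) b = ennpowr x (a * b)"
  by (cases x) (auto simp: ennpowr_ennreal powr_powr)

lemma measurable_ennpowr [measurable]:
  "f \<in> borel_measurable M \<Longrightarrow> (\<lambda>x. ennpowr (f x) a) \<in> borel_measurable M"
proof -
  assume [measurable]: "f \<in> borel_measurable M"
  show ?thesis unfolding ennpowr_def by measurable
qed

text \<open>Jensen's inequality up to a constant.  Integrating the elementary inequality
  \<open>g \<le> c + c powr (1 - m) * g powr m\<close> over \<open>T\<close> and taking \<open>c\<close> to be half the mean value lets the first
  term be absorbed.\<close>
lemma nn_integral_power_mean: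
  assumes g: "g \<in> borel_measurable M" and T: "T \<in> sets M" and L: "emeasure M T \<le> ennreal L" "0 < L"
    and m: "1 \<le> m"
  shows "ennpowr (\<integral>\<^sup>+x\<in>T. g x \<partial>M) m \<le> ennreal (2 powr m * L powr (m - 1)) * (\<integral>\<^sup>+x\<in>T. ennpowr (g x) m \<partial>M)"
    (is "ennpowr ?A m \<le> ennreal ?K * ?B")
proof (cases "?B = top")
  case True
  then show ?thesis using L by (simp add: ennreal_mult_top)
next
  case False
  have le: "g x \<le> ennreal c + ennreal (c powr (1 - m)) * ennpowr (g x) m" if c: "c > 0" for c x
  proof (cases "g x")
    case (real r)
    have "r \<le> c + c powr (1 - m) * r powr m"
    proof (cases "r \<le> c")
      case False
      have "r = r powr (1 - m) * r powr m" using False c by (simp flip: powr_add)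
      also have "\<dots> \<le> c powr (1 - m) * r powr m"
        using False c m by (intro mult_right_mono powr_mono2') auto
      finally show ?thesis using c by linarith
    qed (use real in \<open>simp add: add_increasing2\<close>)
    then show ?thesis using real c by (simp add: ennpowr_ennreal flip: ennreal_mult ennreal_plus)
  qed (use c in \<open>simp add: ennreal_mult_top\<close>)
  have AB: "?A \<le> ennreal (c * L) + ennreal (c powr (1 - m)) * ?B" if c: "c > 0" for c
  proof -
    have "?A \<le> (\<integral>\<^sup>+x. ennreal c * indicator T x + ennreal (c powr (1 - m)) * (ennpowr (g x) m * indicator T x) \<partial>M)"
      using le[OF c] by (intro nn_integral_mono) (auto split: split_indicator)
    also have "\<dots> = ennreal c * emeasure M T + ennreal (c powr (1 - m)) * ?B"
      using g T by (subst nn_integral_add) (auto simp: nn_integral_cmult nn_integral_cmult_indicator)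
    also have "\<dots> \<le> ennreal c * ennreal L + ennreal (c powr (1 - m)) * ?B"
      by (intro add_right_mono mult_left_mono L) auto
    finally show ?thesis using c by (simp add: ennreal_mult')
  qed
  obtain b where b: "?B = ennreal b" "b \<ge> 0" using False by (cases ?B) auto
  have "?A \<le> ennreal (1 * L + 1 powr (1 - m) * b)" using AB[of 1] b L by simp
  then obtain a where a: "?A = ennreal a" "a \<ge> 0" by (cases ?A) (auto simp: top_unique)
  show ?thesis
  proof (cases "a = 0")
    case False
    define c where "c = a / (2 * L)"
    have c: "c > 0" using False a L by (simp add: c_def)
    have "ennreal a \<le> ennreal (c * L + c powr (1 - m) * b)"
      using AB[OF c] a b c L by (simp flip: ennreal_mult ennreal_plus)
    then have "a \<le> c * L + c powr (1 - m) * b"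
      using b c L by (subst (asm) ennreal_le_iff) auto
    moreover have "c * L = a / 2" using L by (simp add: c_def)
    ultimately have "a / 2 * c powr (m - 1) \<le> c powr (1 - m) * b * c powr (m - 1)"
      by (intro mult_right_mono) auto
    also have "\<dots> = b" using c by (simp add: mult.assoc mult.left_commute[of _ b] flip: powr_add)
    finally have "a * c powr (m - 1) \<le> 2 * b" by simp
    moreover have "a * c powr (m - 1) = a powr m / ((2 * L) powr (m - 1))"
      using False a L by (simp add: c_def powr_divide powr_diff)
    ultimately have "a powr m \<le> 2 * b * (2 * L) powr (m - 1)"
      using L by (simp add: divide_le_eq)
    also have "\<dots> = ?K * b" using L by (simp add: powr_mult powr_diff)
    finally show ?thesis using a b L by (simp add: ennpowr_ennreal flip: ennreal_mult)
  qed (use a in simp)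
qed

section \<open>Local bounds for powers of harmonic functions\<close>
lemma nn_integral_lborel_affine:
  fixes g :: "'a::euclidean_space \<Rightarrow> ennreal"
  assumes [measurable]: "g \<in> borel_measurable borel" and s: "s > 0"
  shows "(\<integral>\<^sup>+w. g w \<partial>lborel) = ennreal (s ^ DIM('a)) * (\<integral>\<^sup>+y. g (z + s *\<^sub>R y) \<partial>lborel)"
  using s
  by (subst lborel_affine[of s z])
     (simp_all add: nn_integral_density nn_integral_distr nn_integral_cmult ennreal_power)

lemma harmonic_on_imp_continuous_on:
  fixes f :: "'a::euclidean_space \<Rightarrow> 'b::real_normed_vector"
  assumes "harmonic_on f S" shows "continuous_on S f"
proof -
  obtain f' where "\<forall>z\<in>S. (f has_derivative f' z) (at z)"
    using assms unfolding harmonic_on_def by blast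
  then show ?thesis
    by (meson continuous_on_eq_continuous_within has_derivative_at_withinI has_derivative_continuous)
qed

lemma borel_measurable_norm_powr_indicator:
  fixes f :: "'a::euclidean_space \<Rightarrow> 'b::real_normed_vector"
  assumes "closed Q" "continuous_on Q f" "0 < p"
  shows "(\<lambda>w. ennreal (norm (f w) powr p) * indicator Q w) \<in> borel_measurable borel"
proof -
  have "(\<lambda>w. indicator Q w *\<^sub>R norm (f w) powr p) \<in> borel_measurable borel"
    using assms by (intro borel_measurable_continuous_on_indicator continuous_on_powr' continuous_intros) auto
  then have "(\<lambda>w. ennreal (indicator Q w *\<^sub>R norm (f w) powr p)) \<in> borel_measurable borel" by measurable
  also have "(\<lambda>w. ennreal (indicator Q w *\<^sub>R norm (f w) powr p)) = (\<lambda>w. ennreal (norm (f w) powr p) * indicator Q w)"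
    by (auto simp: fun_eq_iff split: split_indicator)
  finally show ?thesis .
qed

text \<open>The mean value identity with its weight estimated by 1 and the variable of integration rescaled.\<close>
lemma harmonic_norm_le_ball_average:
  obtains C :: real where "C > 0"
    "\<And>f :: 'a::euclidean_space \<Rightarrow> 'b::euclidean_space. \<And>S z s. harmonic_on f S \<Longrightarrow> 0 < s \<Longrightarrow> cball z s \<subseteq> S \<Longrightarrow>
       ennreal (norm (f z)) \<le> ennreal (C / s ^ DIM('a)) * (\<integral>\<^sup>+w\<in>cball z s. ennreal (norm (f w)) \<partial>lborel)"
proof -
  let ?W = "cbox (- (2 *\<^sub>R One)) (2 *\<^sub>R One) :: 'a set"
  define I where "I = integral ?W bump"
  have I: "I > 0" unfolding I_def by (rule integral_bump_pos)
  show ?thesis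
  proof (rule that[of "1 / I"])
    fix f :: "'a \<Rightarrow> 'b" and S z s
    assume f: "harmonic_on f S" and s: "0 < s" and zS: "cball z s \<subseteq> S"
    have cf: "continuous_on (cball z s) f"
      using harmonic_on_imp_continuous_on[OF f] zS by (rule continuous_on_subset)
    have cl: "closed {y::'a. norm y \<le> 1}" "closed {y::'a. 1 \<le> norm y}"
      by (intro closed_Collect_le continuous_intros)+
    have inS: "z + s *\<^sub>R y \<in> cball z s" if "norm y \<le> 1" for y
      using that s mult_left_mono[of "norm y" 1 s] by (simp add: dist_norm)
    define g where "g w = ennreal (norm (f w)) * indicator (cball z s) w" for w
    have g_meas [measurable]: "g \<in> borel_measurable borel"
    proof -
      have "(\<lambda>w. indicator (cball z s) w *\<^sub>R norm (f w)) \<in> borel_measurable borel"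
        by (rule borel_measurable_continuous_on_indicator) (auto intro!: continuous_intros cf)
      then have "(\<lambda>w. ennreal (indicator (cball z s) w *\<^sub>R norm (f w))) \<in> borel_measurable borel" by measurable
      also have "(\<lambda>w. ennreal (indicator (cball z s) w *\<^sub>R norm (f w))) = g"
        by (auto simp: g_def fun_eq_iff split: split_indicator)
      finally show ?thesis .
    qed
    have c: "continuous_on ?W (\<lambda>y. bump y *\<^sub>R f (z + s *\<^sub>R y))"
      by (rule continuous_on_mult_supported[OF _ cl(1) _ cl(2)])
        (auto intro!: continuous_intros continuous_on_compose2[OF cf] inS simp: bump_eq_0)
    define h where "h y = norm (bump y *\<^sub>R f (z + s *\<^sub>R y))" for y
    have ch: "continuous_on ?W h" unfolding h_def by (intro continuous_intros c)
    have "I * norm (f z) = norm (integral ?W (\<lambda>y. bump y *\<^sub>R f (z + s *\<^sub>R y)))"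
      using harmonic_bump_mean_value[OF f zS] s I by (simp add: I_def)
    also have "\<dots> \<le> integral ?W h"
      using c ch by (intro Henstock_Kurzweil_Integration.integral_norm_bound_integral integrable_continuous) (auto simp: h_def)
    finally have "ennreal (I * norm (f z)) \<le> ennreal (integral ?W h)" by (rule ennreal_leI)
    also have "\<dots> = (\<integral>\<^sup>+y\<in>?W. ennreal (h y) \<partial>lborel)"
    proof (rule nn_integral_has_integral_lebesgue'[symmetric])
      show "(h has_integral integral ?W h) ?W" by (intro integrable_integral integrable_continuous ch)
    qed (auto simp: h_def)
    also have "\<dots> \<le> (\<integral>\<^sup>+y. g (z + s *\<^sub>R y) \<partial>lborel)"
    proof (rule nn_integral_mono)
      fix y :: 'a
      show "ennreal (h y) * indicator ?W y \<le> g (z + s *\<^sub>R y)"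
      proof (cases "norm y \<le> 1")
        case True
        have "h y \<le> norm (f (z + s *\<^sub>R y))" by (simp add: h_def bump_nonneg bump_le_1 mult_left_le_one_le)
        then show ?thesis using inS[OF True] by (auto simp: g_def intro!: ennreal_leI split: split_indicator)
      qed (simp add: h_def bump_eq_0)
    qed
    finally have 1: "ennreal (I * norm (f z)) \<le> (\<integral>\<^sup>+y. g (z + s *\<^sub>R y) \<partial>lborel)" .
    have "ennreal (norm (f z)) = ennreal (1 / I / s ^ DIM('a)) * (ennreal (s ^ DIM('a)) * ennreal (I * norm (f z)))"
      using I s by (simp flip: ennreal_mult)
    also have "\<dots> \<le> ennreal (1 / I / s ^ DIM('a)) * (ennreal (s ^ DIM('a)) * (\<integral>\<^sup>+y. g (z + s *\<^sub>R y) \<partial>lborel))"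
      by (intro mult_left_mono 1) auto
    also have "\<dots> = ennreal (1 / I / s ^ DIM('a)) * (\<integral>\<^sup>+w. g w \<partial>lborel)"
      by (subst nn_integral_lborel_affine[OF g_meas s, of z]) (rule refl)
    finally show "ennreal (norm (f z)) \<le> ennreal (1 / I / s ^ DIM('a)) * (\<integral>\<^sup>+w\<in>cball z s. ennreal (norm (f w)) \<partial>lborel)"
      by (simp add: g_def)
  qed (use I in simp)
qed

lemma harmonic_norm_powr_le_ball_average_ge_1:
  fixes p :: real
  assumes p: "1 \<le> p"
  obtains C :: real where "C > 0"
    "\<And>f :: 'a::euclidean_space \<Rightarrow> 'b::euclidean_space. \<And>S z s. harmonic_on f S \<Longrightarrow> 0 < s \<Longrightarrow> cball z s \<subseteq> S \<Longrightarrow>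
       ennreal (norm (f z) powr p) \<le> ennreal (C / s ^ DIM('a)) * (\<integral>\<^sup>+w\<in>cball z s. ennreal (norm (f w) powr p) \<partial>lborel)"
proof -
  obtain C :: real where C: "C > 0" and mean:
    "\<And>f :: 'a \<Rightarrow> 'b. \<And>S z s. harmonic_on f S \<Longrightarrow> 0 < s \<Longrightarrow> cball z s \<subseteq> S \<Longrightarrow>
       ennreal (norm (f z)) \<le> ennreal (C / s ^ DIM('a)) * (\<integral>\<^sup>+w\<in>cball z s. ennreal (norm (f w)) \<partial>lborel)"
    using harmonic_norm_le_ball_average by blast
  let ?v = "unit_ball_vol (real DIM('a))"
  have v: "?v > 0" by simp
  show ?thesis
  proof (rule that[of "C powr p * (2 powr p * ?v powr (p - 1))"])
    fix f :: "'a \<Rightarrow> 'b" and S z s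
    assume f: "harmonic_on f S" and s: "0 < s" and zS: "cball z s \<subseteq> S"
    have cf: "continuous_on (cball z s) f"
      using harmonic_on_imp_continuous_on[OF f] zS by (rule continuous_on_subset)
    define M where "M = restrict_space lborel (cball z s)"
    have meas: "(\<lambda>w. ennreal (norm (f w))) \<in> borel_measurable M"
    proof -
      have "f \<in> borel_measurable (restrict_space borel (cball z s))"
        by (rule borel_measurable_continuous_on_restrict[OF cf])
      then have "f \<in> borel_measurable M"
        by (simp add: M_def cong: measurable_cong_sets sets_restrict_space_cong)
      then show ?thesis by measurable
    qed
    have sM: "space M = cball z s" by (simp add: M_def space_restrict_space)
    have int: "(\<integral>\<^sup>+w\<in>cball z s. u w \<partial>lborel) = (\<integral>\<^sup>+w\<in>space M. u w \<partial>M)" for u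
      unfolding sM unfolding M_def by (subst nn_integral_restrict_space) (auto simp: mult.assoc split: split_indicator intro!: nn_integral_cong)
    have em: "emeasure M (space M) \<le> ennreal (?v * s ^ DIM('a))"
      unfolding sM unfolding M_def using s by (simp add: emeasure_restrict_space emeasure_cball)
    have "ennreal (norm (f z) powr p) = ennpowr (ennreal (norm (f z))) p" by (simp add: ennpowr_ennreal)
    also have "\<dots> \<le> ennpowr (ennreal (C / s ^ DIM('a)) * (\<integral>\<^sup>+w\<in>cball z s. ennreal (norm (f w)) \<partial>lborel)) p"
      using p by (intro ennpowr_mono mean[OF f s zS]) auto
    also have "\<dots> = ennreal ((C / s ^ DIM('a)) powr p) * ennpowr (\<integral>\<^sup>+w\<in>space M. ennreal (norm (f w)) \<partial>M) p"
      using C s by (simp add: ennpowr_mult ennpowr_ennreal int)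
    also have "\<dots> \<le> ennreal ((C / s ^ DIM('a)) powr p) * (ennreal (2 powr p * (?v * s ^ DIM('a)) powr (p - 1)) *
         (\<integral>\<^sup>+w\<in>space M. ennpowr (ennreal (norm (f w))) p \<partial>M))"
      using s v p by (intro mult_left_mono nn_integral_power_mean meas em) auto
    also have "(\<integral>\<^sup>+w\<in>space M. ennpowr (ennreal (norm (f w))) p \<partial>M) = (\<integral>\<^sup>+w\<in>cball z s. ennreal (norm (f w) powr p) \<partial>lborel)"
      by (simp add: int ennpowr_ennreal)
    also have "ennreal ((C / s ^ DIM('a)) powr p) * (ennreal (2 powr p * (?v * s ^ DIM('a)) powr (p - 1)) * (\<integral>\<^sup>+w\<in>cball z s. ennreal (norm (f w) powr p) \<partial>lborel))
      = ennreal ((C / s ^ DIM('a)) powr p * (2 powr p * (?v * s ^ DIM('a)) powr (p - 1))) * (\<integral>\<^sup>+w\<in>cball z s. ennreal (norm (f w) powr p) \<partial>lborel)"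
      by (simp add: ennreal_mult mult.assoc)
    also have "(C / s ^ DIM('a)) powr p * (2 powr p * (?v * s ^ DIM('a)) powr (p - 1))
        = C powr p * (2 powr p * ?v powr (p - 1)) / s ^ DIM('a)"
      using C s v by (simp add: powr_divide powr_mult powr_diff)
    finally show "ennreal (norm (f z) powr p) \<le> ennreal (C powr p * (2 powr p * ?v powr (p - 1)) / s ^ DIM('a)) *
        (\<integral>\<^sup>+w\<in>cball z s. ennreal (norm (f w) powr p) \<partial>lborel)" .
  qed (use C v in \<open>simp add: less_imp_neq[symmetric]\<close>)
qed

text \<open>For \<open>p < 1\<close> the function \<open>|f| powr p\<close> need not be subharmonic, and an argument of Hardy and
  Littlewood is used.  Let \<open>w0\<close> maximise \<open>\<Phi> w = \<delta> w powr (d / p) * |f w|\<close>, where \<open>\<delta>\<close> is the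
  distance to the boundary of the ball and \<open>d\<close> the dimension.  On the ball of radius \<open>\<delta> w0 / 2\<close> about
  \<open>w0\<close> the maximality bounds \<open>|f|\<close> by a constant multiple \<open>K\<close> of \<open>|f w0|\<close>, so
  \<open>|f| \<le> K powr (1 - p) * |f| powr p\<close> there, and the case \<open>p = 1\<close> at \<open>w0\<close> bounds \<open>\<Phi> w0\<close>, which
  dominates \<open>\<Phi> z\<close>.\<close>
lemma harmonic_norm_powr_le_ball_average_less_1:
  fixes p :: real
  assumes p: "0 < p" "p < 1"
  obtains C :: real where "C > 0"
    "\<And>f :: 'a::euclidean_space \<Rightarrow> 'b::euclidean_space. \<And>S z s. harmonic_on f S \<Longrightarrow> 0 < s \<Longrightarrow> cball z s \<subseteq> S \<Longrightarrow>
       ennreal (norm (f z) powr p) \<le> ennreal (C / s ^ DIM('a)) * (\<integral>\<^sup>+w\<in>cball z s. ennreal (norm (f w) powr p) \<partial>lborel)"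
proof -
  obtain C :: real where C: "C > 0" and mean:
    "\<And>f :: 'a \<Rightarrow> 'b. \<And>S z s. harmonic_on f S \<Longrightarrow> 0 < s \<Longrightarrow> cball z s \<subseteq> S \<Longrightarrow>
       ennreal (norm (f z)) \<le> ennreal (C / s ^ DIM('a)) * (\<integral>\<^sup>+w\<in>cball z s. ennreal (norm (f w)) \<partial>lborel)"
    using harmonic_norm_le_ball_average by blast
  let ?d = "real DIM('a)"
  show ?thesis
  proof (rule that[of "C * 2 powr (?d / p)"])
    fix f :: "'a \<Rightarrow> 'b" and S z s
    assume f: "harmonic_on f S" and s: "0 < s" and zS: "cball z s \<subseteq> S"
    let ?I = "\<integral>\<^sup>+w\<in>cball z s. ennreal (norm (f w) powr p) \<partial>lborel"
    have cf: "continuous_on (cball z s) f"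
      using harmonic_on_imp_continuous_on[OF f] zS by (rule continuous_on_subset)
    define \<delta> where "\<delta> w = s - dist z w" for w
    define \<Phi> where "\<Phi> w = \<delta> w powr (?d / p) * norm (f w)" for w
    have "continuous_on (cball z s) \<Phi>"
      unfolding \<Phi>_def \<delta>_def using p by (intro continuous_intros cf continuous_on_powr') auto
    then obtain w0 where w0: "w0 \<in> cball z s" and max: "\<And>w. w \<in> cball z s \<Longrightarrow> \<Phi> w \<le> \<Phi> w0"
      using continuous_attains_sup[of "cball z s" \<Phi>] s by (auto simp: ball_def)
    have \<Phi>z: "\<Phi> z powr p = s ^ DIM('a) * norm (f z) powr p"
      using s p by (simp add: \<Phi>_def \<delta>_def powr_mult powr_powr powr_realpow)
    have key: "ennreal (\<Phi> w0 powr p) \<le> ennreal (C * 2 powr (?d / p)) * ?I"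
    proof (cases "\<Phi> w0 = 0")
      case False
      then have \<delta>0: "\<delta> w0 > 0" and f0: "norm (f w0) > 0" using w0 by (auto simp: \<Phi>_def \<delta>_def)
      define \<rho> where "\<rho> = \<delta> w0 / 2"
      have \<rho>: "\<rho> > 0" using \<delta>0 by (simp add: \<rho>_def)
      have \<delta>ge: "\<delta> v \<ge> \<rho>" if "v \<in> cball w0 \<rho>" for v
        using that dist_triangle[of z v w0] by (simp add: \<delta>_def \<rho>_def)
      have sub: "cball w0 \<rho> \<subseteq> cball z s"
        using \<delta>ge \<rho> by (fastforce simp: \<delta>_def)
      define K where "K = 2 powr (?d / p) * norm (f w0)"
      have K: "K > 0" using f0 by (simp add: K_def)
      have fK: "norm (f v) \<le> K" if v: "v \<in> cball w0 \<rho>" for v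
      proof -
        have "\<rho> powr (?d / p) * norm (f v) \<le> \<Phi> v"
          unfolding \<Phi>_def using \<delta>ge[OF v] \<rho> p by (intro mult_right_mono powr_mono2) auto
        also have "\<dots> \<le> \<Phi> w0" using sub v by (intro max) auto
        also have "\<dots> = \<rho> powr (?d / p) * K"
          using \<delta>0 by (simp add: \<Phi>_def K_def \<rho>_def powr_divide)
        finally show ?thesis using \<rho> by simp
      qed
      have fv: "norm (f v) \<le> K powr (1 - p) * norm (f v) powr p" if v: "v \<in> cball w0 \<rho>" for v
      proof (cases "f v = 0")
        case False
        then have "norm (f v) = norm (f v) powr (1 - p) * norm (f v) powr p" by (simp flip: powr_add)
        also have "\<dots> \<le> K powr (1 - p) * norm (f v) powr p"
          using fK[OF v] p by (intro mult_right_mono powr_mono2) auto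
        finally show ?thesis .
      qed simp
      show ?thesis
      proof (cases "?I = top")
        case True
        then show ?thesis using C by (simp add: ennreal_mult_top)
      next
        case False
        then obtain i where i: "?I = ennreal i" "i \<ge> 0" by (cases ?I) auto
        have "ennreal (norm (f w0)) \<le> ennreal (C / \<rho> ^ DIM('a)) * (\<integral>\<^sup>+w\<in>cball w0 \<rho>. ennreal (norm (f w)) \<partial>lborel)"
          using sub zS by (intro mean[OF f \<rho>]) auto
        also have "(\<integral>\<^sup>+w\<in>cball w0 \<rho>. ennreal (norm (f w)) \<partial>lborel) \<le> (\<integral>\<^sup>+w. ennreal (K powr (1 - p)) * (ennreal (norm (f w) powr p) * indicator (cball z s) w) \<partial>lborel)"
          using sub fv by (intro nn_integral_mono) (auto simp flip: ennreal_mult intro!: ennreal_leI split: split_indicator)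
        also have "\<dots> = ennreal (K powr (1 - p)) * ?I"
        using cf p by (intro nn_integral_cmult) (simp add: borel_measurable_norm_powr_indicator)
        finally have "ennreal (norm (f w0)) \<le> ennreal (C / \<rho> ^ DIM('a) * (K powr (1 - p) * i))"
          using C \<rho> i by (simp add: mult_left_mono flip: ennreal_mult)
        then have "norm (f w0) \<le> C / \<rho> ^ DIM('a) * (K powr (1 - p) * i)"
          using C \<rho> i by (subst (asm) ennreal_le_iff) auto
        then have "norm (f w0) * \<rho> ^ DIM('a) \<le> C * i * K powr (1 - p)"
          using \<rho> by (simp add: field_simps)
        then have "norm (f w0) * \<rho> ^ DIM('a) * K powr (p - 1) \<le> C * i * (K powr (1 - p) * K powr (p - 1))"
          using K by (metis mult.assoc mult_right_mono powr_ge_zero)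
        also have "K powr (1 - p) * K powr (p - 1) = 1" using K by (simp flip: powr_add)
        finally have 1: "norm (f w0) * \<rho> ^ DIM('a) * K powr (p - 1) \<le> C * i" by simp
        have "?d * (p - 1) / p = - (?d / p) + ?d" using p by (simp add: field_simps)
        then have "2 powr (?d * (p - 1) / p) = 2 powr (- (?d / p)) * 2 ^ DIM('a)"
          by (simp only: powr_add powr_realpow zero_less_numeral)
        then have "norm (f w0) * \<rho> ^ DIM('a) * K powr (p - 1) = norm (f w0) powr p * \<delta> w0 powr ?d * 2 powr (- (?d / p))"
          using f0 \<delta>0 p by (simp add: K_def \<rho>_def powr_mult powr_powr power_divide powr_diff powr_realpow powr_minus_divide)
        also have "norm (f w0) powr p * \<delta> w0 powr ?d = \<Phi> w0 powr p"
          using p \<delta>0 by (simp add: \<Phi>_def powr_mult powr_powr)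
        finally have "\<Phi> w0 powr p * 2 powr (- (?d / p)) \<le> C * i"
          using 1 by simp
        then have "\<Phi> w0 powr p \<le> C * i * 2 powr (?d / p)"
          by (simp add: powr_minus_divide divide_le_eq)
        then show ?thesis using i C by (simp add: ac_simps flip: ennreal_mult)
      qed
    qed simp
    have "ennreal (norm (f z) powr p) = ennreal (1 / s ^ DIM('a)) * ennreal (\<Phi> z powr p)"
      using s by (simp add: \<Phi>z flip: ennreal_mult)
    also have "\<dots> \<le> ennreal (1 / s ^ DIM('a)) * (ennreal (C * 2 powr (?d / p)) * ?I)"
    proof (intro mult_left_mono order.trans[OF _ key] ennreal_leI powr_mono2)
      show "0 \<le> \<Phi> z" by (simp add: \<Phi>_def)
    qed (use p s in \<open>auto intro!: max\<close>)
    also have "\<dots> = ennreal (C * 2 powr (?d / p) / s ^ DIM('a)) * ?I"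
      using C s by (simp add: ennreal_mult[symmetric] mult.assoc[symmetric])
    finally show "ennreal (norm (f z) powr p) \<le> ennreal (C * 2 powr (?d / p) / s ^ DIM('a)) * ?I" .
  qed (use C in simp)
qed

lemma harmonic_norm_powr_le_ball_average:
  fixes p :: real
  assumes p: "0 < p"
  obtains C :: real where "C > 0"
    "\<And>f :: 'a::euclidean_space \<Rightarrow> 'b::euclidean_space. \<And>S z s. harmonic_on f S \<Longrightarrow> 0 < s \<Longrightarrow> cball z s \<subseteq> S \<Longrightarrow>
       ennreal (norm (f z) powr p) \<le> ennreal (C / s ^ DIM('a)) * (\<integral>\<^sup>+w\<in>cball z s. ennreal (norm (f w) powr p) \<partial>lborel)"
  using harmonic_norm_powr_le_ball_average_ge_1[of p thesis] harmonic_norm_powr_le_ball_average_less_1[of p thesis]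
    that p by (cases "1 \<le> p") auto

section \<open>Geometry of Whitney cubes and estimates on a single cube\<close>

text \<open>The embedding of \<open>\<ell>\<^sup>1\<close> into \<open>\<ell>\<^sup>m\<close>; this is where \<open>p \<le> q\<close> allows the contributions of the cubes
  to be added up.\<close>
lemma suminf_ennpowr_le:
  assumes m: "1 \<le> m"
  shows "(\<Sum>k. ennpowr (a k) m) \<le> ennpowr (\<Sum>k. a k) m"
proof (cases "\<Sum>k. a k")
  case (real s)
  have le: "ennpowr (a k) m \<le> a k * ennreal (s powr (m - 1))" for k
  proof -
    have "a k \<le> ennreal s"
      using sum_le_suminf[of a "{k}"] real by simp
    then obtain x where x: "a k = ennreal x" "0 \<le> x" "x \<le> s"
      using real by (cases "a k") (auto simp: top_unique)
    have "x powr m = x * x powr (m - 1)" using x by (cases "x = 0") (auto simp: powr_diff)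
    also have "\<dots> \<le> x * s powr (m - 1)" using x m by (intro mult_left_mono powr_mono2) auto
    finally show ?thesis using x by (simp add: ennpowr_ennreal ennreal_leI flip: ennreal_mult)
  qed
  have "(\<Sum>k. ennpowr (a k) m) \<le> (\<Sum>k. a k * ennreal (s powr (m - 1)))"
    by (intro suminf_le le) auto
  also have "\<dots> = ennreal s * ennreal (s powr (m - 1))" by (simp add: real)
  also have "\<dots> = ennreal (s powr m)" using real by (cases "s = 0") (auto simp: powr_diff simp flip: ennreal_mult)
  finally show ?thesis using real by (simp add: ennpowr_ennreal)
qed simp

lemma mem_cube_iff: "z \<in> cube c \<rho> \<longleftrightarrow> (\<forall>b\<in>Basis. \<bar>(z - c) \<bullet> b\<bar> \<le> \<rho>)"
  unfolding cube_def mem_box by (intro ball_cong refl) (auto simp: inner_simps abs_le_iff)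

lemma mem_cube_Pair_iff: "(x, t) \<in> cube (c, d) \<rho> \<longleftrightarrow> x \<in> cube c \<rho> \<and> \<bar>t - d\<bar> \<le> \<rho>"
  unfolding mem_cube_iff Basis_prod_def by (auto simp: ball_Un)

lemma cube_mono: "\<rho> \<le> \<rho>' \<Longrightarrow> cube c \<rho> \<subseteq> cube c \<rho>'"
  unfolding mem_cube_iff subset_iff by (meson order_trans)

lemma cball_subset_cube: "cball c \<rho> \<subseteq> cube c \<rho>"
  unfolding mem_cube_iff subset_iff mem_cball dist_norm norm_minus_commute[of c]
  using Basis_le_norm order_trans by blast

lemma cball_subset_enlarged_cube:
  assumes "z \<in> cube c \<rho>" shows "cball z \<epsilon> \<subseteq> cube c (\<rho> + \<epsilon>)"
proof
  fix w assume "w \<in> cball z \<epsilon>"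
  then have "w \<in> cube z \<epsilon>" using cball_subset_cube by blast
  show "w \<in> cube c (\<rho> + \<epsilon>)"
    unfolding mem_cube_iff
  proof
    fix b :: 'a assume b: "b \<in> Basis"
    have "\<bar>(w - z) \<bullet> b\<bar> \<le> \<epsilon>" "\<bar>(z - c) \<bullet> b\<bar> \<le> \<rho>"
      using b assms \<open>w \<in> cube z \<epsilon>\<close> by (auto simp: mem_cube_iff)
    then show "\<bar>(w - c) \<bullet> b\<bar> \<le> \<rho> + \<epsilon>" by (simp add: inner_diff_left)
  qed
qed

lemma closed_cube [simp]: "closed (cube c \<rho>)"
  by (simp add: cube_def closed_cbox)

lemma open_upper_half: "open upper_half"
  unfolding upper_half_def by (intro open_Collect_less continuous_intros)

lemma frontier_upper_half: "frontier (upper_half :: ('a::euclidean_space \<times> real) set) = {z. snd z = 0}"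
proof -
  have "frontier {z :: 'a \<times> real. (0, 1) \<bullet> z > 0} = {z. (0, 1) \<bullet> z = 0}"
    by (rule frontier_halfspace_gt) (simp add: zero_prod_def)
  then show ?thesis by (simp add: upper_half_def inner_prod_def)
qed

text \<open>The enlarged cube lies above the boundary, so the height of the centre exceeds the half side; conversely
  the distance to the boundary is at least \<open>\<eta> k - r k\<close>, and it is comparable to the diameter.\<close>
lemma whitney_side_comparable:
  assumes W: "whitney_decomposition \<xi> \<eta> r"
  obtains c where "0 < c" "\<And>k. 0 < r k" "\<And>k. r k \<le> \<eta> k" "\<And>k. \<eta> k \<le> c * r k"
proof -
  have r: "0 < r k" for k using W by (simp add: whitney_decomposition_def)
  have sub: "cube (\<xi> k, \<eta> k) (5 / 4 * r k) \<subseteq> upper_half" for k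
    using W by (simp add: whitney_decomposition_def)
  have r\<eta>: "r k < \<eta> k" for k
  proof -
    have "(\<xi> k, \<eta> k - 5 / 4 * r k) \<in> cube (\<xi> k, \<eta> k) (5 / 4 * r k)"
      using r[of k] by (simp add: mem_cube_Pair_iff) (simp add: mem_cube_iff)
    then have "(\<xi> k, \<eta> k - 5 / 4 * r k) \<in> upper_half" using sub by blast
    then have "\<eta> k - 5 / 4 * r k > 0" by (simp add: upper_half_def)
    then show ?thesis using r[of k] by simp
  qed
  obtain a where a: "0 < a" and diam:
    "\<And>k. a * setdist (cube (\<xi> k, \<eta> k) (r k)) (frontier upper_half) \<le> diameter (cube (\<xi> k, \<eta> k) (r k))"
    using W unfolding whitney_decomposition_def by metis
  let ?N = "norm (One :: 'a \<times> real)"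
  have "\<eta> k \<le> (1 + 2 * ?N / a) * r k" for k
  proof -
    have "\<eta> k - r k \<le> setdist (cube (\<xi> k, \<eta> k) (r k)) (frontier upper_half)"
    proof (rule le_setdistI)
      fix z w assume z: "z \<in> cube (\<xi> k, \<eta> k) (r k)" and w: "w \<in> frontier (upper_half :: ('a \<times> real) set)"
      have "\<eta> k - r k \<le> snd z" using z by (cases z) (auto simp: mem_cube_Pair_iff)
      also have "\<dots> \<le> dist (snd z) (snd w)" using w by (simp add: frontier_upper_half dist_real_def)
      also have "\<dots> \<le> dist z w" by (rule dist_snd_le)
      finally show "\<eta> k - r k \<le> dist z w" .
    next
      have "(\<xi> k, \<eta> k) \<in> cube (\<xi> k, \<eta> k) (r k)" using r[of k] by (simp add: mem_cube_iff)
      then show "cube (\<xi> k, \<eta> k) (r k) \<noteq> {}" by blast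
      have "(0, 0) \<in> frontier (upper_half :: ('a \<times> real) set)" by (simp add: frontier_upper_half)
      then show "frontier (upper_half :: ('a \<times> real) set) \<noteq> {}" by blast
    qed
    then have "a * (\<eta> k - r k) \<le> a * setdist (cube (\<xi> k, \<eta> k) (r k)) (frontier upper_half)"
      using a by (intro mult_left_mono) auto
    also have "\<dots> \<le> diameter (cube (\<xi> k, \<eta> k) (r k))" by (rule diam)
    also have "\<dots> = dist ((\<xi> k, \<eta> k) - r k *\<^sub>R One) ((\<xi> k, \<eta> k) + r k *\<^sub>R One)"
      unfolding cube_def using r[of k] by (intro diameter_cbox) (simp add: inner_simps)
    also have "\<dots> = norm ((2 * r k) *\<^sub>R (One :: 'a \<times> real))"
      by (simp add: dist_norm norm_minus_commute scaleR_2 flip: scaleR_scaleR)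
    also have "\<dots> = 2 * r k * ?N" using r[of k] by simp
    finally show ?thesis using a by (simp add: field_simps)
  qed
  moreover have "0 < 1 + 2 * ?N / a" using a by (intro add_pos_nonneg) auto
  ultimately show ?thesis using r r\<eta> by (intro that[of "1 + 2 * ?N / a"]) (auto intro: less_imp_le)
qed

lemma cube_in_sets_upper_half:
  assumes W: "whitney_decomposition \<xi> \<eta> r" and sets: "sets \<mu> = sets (restrict_space borel upper_half)"
  shows "cube (\<xi> k, \<eta> k) (r k) \<in> sets \<mu>"
proof -
  have "cube (\<xi> k, \<eta> k) (r k) \<subseteq> upper_half" using W unfolding whitney_decomposition_def by blast
  then show ?thesis
    unfolding sets using open_upper_half
    by (subst sets_restrict_space_iff) (auto intro: borel_closed borel_open)
qed

lemma ennpowr_slice_norm: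
  "p > 0 \<Longrightarrow> ennpowr (slice_norm p f t) q = ennpowr (\<integral>\<^sup>+x. ennreal (norm (f (x, t)) powr p) \<partial>lborel) (q / p)"
  by (simp add: slice_norm_def Lp_norm_def ennpowr_ennpowr)

lemma powr_comparable_le:
  fixes t \<eta> :: real
  assumes "0 < a" "0 < b" "0 < \<eta>" "a * \<eta> \<le> t" "t \<le> b * \<eta>"
  shows "\<eta> powr e \<le> max (a powr (- e)) (b powr (- e)) * t powr e"
proof -
  have t: "t > 0" using assms by (smt (verit) mult_pos_pos)
  show ?thesis
  proof (cases "e \<ge> 0")
    case True
    have "\<eta> powr e = a powr (- e) * (a * \<eta>) powr e" using assms by (simp add: powr_mult powr_minus)
    also have "\<dots> \<le> max (a powr (- e)) (b powr (- e)) * t powr e"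
      using assms True by (intro mult_mono powr_mono2) (auto simp: le_max_iff_disj)
    finally show ?thesis .
  next
    case False
    have "\<eta> powr e = b powr (- e) * (b * \<eta>) powr e" using assms by (simp add: powr_mult powr_minus)
    also have "\<dots> \<le> max (a powr (- e)) (b powr (- e)) * t powr e"
      using assms False t by (intro mult_mono powr_mono2') (auto simp: le_max_iff_disj)
    finally show ?thesis .
  qed
qed

text \<open>A ball of radius \<open>r / 4\<close> about any point of a cube stays inside the enlarged cube, so the sub-mean-value
  property bounds \<open>|f z| powr p\<close> by the integral over the enlarged cube.  The power \<open>q / p\<close> is then
  moved inside the integral over \<open>t\<close> only: the integral over \<open>x\<close> has to keep its power outside, as in
  the mixed norm.\<close>
lemma harmonic_powr_le_on_cube:
  fixes p q :: real
  assumes p: "0 < p" and pq: "p \<le> q"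
  obtains K :: real where "0 < K"
    "\<And>(f :: 'a::euclidean_space \<times> real \<Rightarrow> 'b::euclidean_space) (\<xi> :: 'a) \<eta> r z.
       harmonic_on f upper_half \<Longrightarrow> 0 < r \<Longrightarrow> cube (\<xi>, \<eta>) (5 / 4 * r) \<subseteq> upper_half \<Longrightarrow> z \<in> cube (\<xi>, \<eta>) r \<Longrightarrow>
       ennreal (norm (f z) powr q) \<le> ennreal (K * r powr (- (real DIM('a) * (q / p)) - 1)) *
         (\<integral>\<^sup>+t\<in>{t. \<bar>t - \<eta>\<bar> \<le> 5 / 4 * r}. ennpowr (\<integral>\<^sup>+x. ennreal (norm (f (x, t)) powr p) * indicator (cube (\<xi>, \<eta>) (5 / 4 * r)) (x, t) \<partial>lborel) (q / p) \<partial>lborel)"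
proof -
  let ?m = "q / p"
  let ?D = "DIM('a \<times> real)"
  have m: "1 \<le> ?m" using p pq by simp
  obtain C :: real where C: "C > 0" and sub:
    "\<And>f :: 'a \<times> real \<Rightarrow> 'b. \<And>S z s. harmonic_on f S \<Longrightarrow> 0 < s \<Longrightarrow> cball z s \<subseteq> S \<Longrightarrow>
       ennreal (norm (f z) powr p) \<le> ennreal (C / s ^ ?D) * (\<integral>\<^sup>+w\<in>cball z s. ennreal (norm (f w) powr p) \<partial>lborel)"
    using harmonic_norm_powr_le_ball_average[OF p] by blast
  define K where "K = (C * 4 ^ ?D) powr ?m * (2 powr ?m * (5 / 2) powr (?m - 1))"
  show ?thesis
  proof (rule that[of K])
    show "0 < K" using C by (simp add: K_def)
    fix f :: "'a \<times> real \<Rightarrow> 'b" and \<xi> :: 'a and \<eta> r z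
    assume f: "harmonic_on f upper_half" and r: "0 < r" and cub: "cube (\<xi>, \<eta>) (5 / 4 * r) \<subseteq> upper_half"
      and z: "z \<in> cube (\<xi>, \<eta>) r"
    let ?Q = "cube (\<xi>, \<eta>) (5 / 4 * r)" and ?T = "{t. \<bar>t - \<eta>\<bar> \<le> 5 / 4 * r}"
    define a where "a t = (\<integral>\<^sup>+x. ennreal (norm (f (x, t)) powr p) * indicator ?Q (x, t) \<partial>lborel)" for t
    have cf: "continuous_on ?Q f"
      using harmonic_on_imp_continuous_on[OF f] cub by (rule continuous_on_subset)
    define F where "F w = ennreal (norm (f w) powr p) * indicator ?Q w" for w
    have F_meas [measurable]: "F \<in> borel_measurable borel"
      unfolding F_def[abs_def] using cf p by (intro borel_measurable_norm_powr_indicator) simp_all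
    have a_eq: "a t = (\<integral>\<^sup>+x. F (x, t) \<partial>lborel)" for t by (simp add: a_def F_def)
    have a_meas [measurable]: "a \<in> borel_measurable lborel"
      unfolding a_eq[abs_def] by measurable
    have a_out: "a t = 0" if "t \<notin> ?T" for t
      using that unfolding a_def by (subst nn_integral_0_iff_AE) (auto simp: mem_cube_Pair_iff split: split_indicator)
    have I: "(\<integral>\<^sup>+w. F w \<partial>lborel) = (\<integral>\<^sup>+t\<in>?T. a t \<partial>lborel)"
    proof -
      have "(\<integral>\<^sup>+w. F w \<partial>lborel) = (\<integral>\<^sup>+t. a t \<partial>lborel)"
        unfolding a_eq lborel_prod[symmetric] by (subst lborel_pair.nn_integral_snd) (simp_all add: lborel_prod)
      also have "\<dots> = (\<integral>\<^sup>+t\<in>?T. a t \<partial>lborel)"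
        by (intro nn_integral_cong) (auto simp: a_out[simplified] split: split_indicator)
      finally show ?thesis .
    qed
    have T_eq: "?T = {\<eta> - 5 / 4 * r..\<eta> + 5 / 4 * r}"
      by (auto simp only: mem_Collect_eq atLeastAtMost_iff)
    have T: "emeasure lborel ?T \<le> ennreal (5 / 2 * r)" "?T \<in> sets lborel"
      unfolding T_eq using r by simp_all
    have "ennreal (norm (f z) powr q) = ennpowr (ennreal (norm (f z) powr p)) ?m"
      using p by (simp add: ennpowr_ennreal powr_powr)
    also have "\<dots> \<le> ennpowr (ennreal (C / (r / 4) ^ ?D) * (\<integral>\<^sup>+w. F w \<partial>lborel)) ?m"
    proof (rule ennpowr_mono)
      have ball: "cball z (r / 4) \<subseteq> ?Q" using cball_subset_enlarged_cube[OF z, of "r / 4"] by simp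
      have "ennreal (norm (f z) powr p) \<le> ennreal (C / (r / 4) ^ ?D) * (\<integral>\<^sup>+w\<in>cball z (r / 4). ennreal (norm (f w) powr p) \<partial>lborel)"
        using r ball cub by (intro sub[OF f]) auto
      also have "\<dots> \<le> ennreal (C / (r / 4) ^ ?D) * (\<integral>\<^sup>+w. F w \<partial>lborel)"
        using ball by (intro mult_left_mono nn_integral_mono) (auto simp: F_def split: split_indicator)
      finally show "ennreal (norm (f z) powr p) \<le> ennreal (C / (r / 4) ^ ?D) * (\<integral>\<^sup>+w. F w \<partial>lborel)" .
    qed (use m in simp)
    also have "\<dots> = ennreal ((C / (r / 4) ^ ?D) powr ?m) * ennpowr (\<integral>\<^sup>+t\<in>?T. a t \<partial>lborel) ?m"
      using C r by (simp add: ennpowr_mult ennpowr_ennreal I)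
    also have "\<dots> \<le> ennreal ((C / (r / 4) ^ ?D) powr ?m) * (ennreal (2 powr ?m * (5 / 2 * r) powr (?m - 1)) *
        (\<integral>\<^sup>+t\<in>?T. ennpowr (a t) ?m \<partial>lborel))"
      using r m by (intro mult_left_mono nn_integral_power_mean T) auto
    also have "\<dots> = ennreal ((C / (r / 4) ^ ?D) powr ?m * (2 powr ?m * (5 / 2 * r) powr (?m - 1))) *
        (\<integral>\<^sup>+t\<in>?T. ennpowr (a t) ?m \<partial>lborel)"
      by (simp add: ennreal_mult mult.assoc)
    also have "(C / (r / 4) ^ ?D) powr ?m * (2 powr ?m * (5 / 2 * r) powr (?m - 1)) =
        K * r powr (- (real DIM('a) * ?m) - 1)"
    proof -
      have "(C / (r / 4) ^ ?D) powr ?m = (C * 4 ^ ?D) powr ?m / (r ^ ?D) powr ?m"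
        using C r by (simp add: power_divide flip: powr_divide)
      also have "(r ^ ?D) powr ?m = r powr (real ?D * ?m)"
        using r by (simp only: powr_powr powr_realpow[symmetric])
      finally have 1: "(C / (r / 4) ^ ?D) powr ?m = (C * 4 ^ ?D) powr ?m * r powr (- (real ?D * ?m))"
        by (simp only: powr_minus_divide) simp
      have "- (real DIM('a) * ?m) - 1 = - (real ?D * ?m) + (?m - 1)" by (simp add: algebra_simps)
      then have "r powr (- (real DIM('a) * ?m) - 1) = r powr (- (real ?D * ?m)) * r powr (?m - 1)"
        by (simp only: powr_add)
      then show ?thesis unfolding 1 K_def using r by (simp only: powr_mult) simp
    qed
    finally show "ennreal (norm (f z) powr q) \<le> ennreal (K * r powr (- (real DIM('a) * ?m) - 1)) *
         (\<integral>\<^sup>+t\<in>?T. ennpowr (\<integral>\<^sup>+x. ennreal (norm (f (x, t)) powr p) * indicator ?Q (x, t) \<partial>lborel) ?m \<partial>lborel)"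
      by (simp add: a_def)
  qed
qed


section \<open>From the measure condition to the embedding\<close>
lemma suminf_indicator_le_card:
  assumes "finite {k. z \<in> A k}" "card {k. z \<in> A k} \<le> N"
  shows "(\<Sum>k. indicator (A k) z :: ennreal) \<le> of_nat N"
proof -
  have "(\<Sum>k. indicator (A k) z :: ennreal) = (\<Sum>k\<in>{k. z \<in> A k}. indicator (A k) z)"
    by (rule suminf_finite) (use assms in auto)
  also have "\<dots> = of_nat (card {k. z \<in> A k})" by simp
  also have "\<dots> \<le> of_nat N" using assms by simp
  finally show ?thesis .
qed

text \<open>Summing over the cubes.  The powers of \<open>\<eta> k\<close> coming from the measure of the cube and from the local
  estimate combine to \<open>\<eta> k powr (\<alpha> * q - 1)\<close>, comparable to the weight \<open>t powr (\<alpha> * q - 1)\<close> on the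
  enlarged cube.  For fixed \<open>t\<close> the integrals \<open>A k t\<close> over the slices of the enlarged cubes add up to at
  most \<open>N\<close> times the integral over the whole slice, by finite overlap.\<close>
lemma carleson_condition_imp_norm_bound:
  fixes p q \<alpha> :: real and \<xi> :: "nat \<Rightarrow> 'a::euclidean_space" and \<mu> :: "('a \<times> real) measure"
  assumes p: "0 < p" and pq: "p \<le> q"
    and W: "whitney_decomposition \<xi> \<eta> r"
    and sets: "sets \<mu> = sets (restrict_space borel upper_half)"
    and C: "0 \<le> C"
    and bound: "\<And>k. emeasure \<mu> (cube (\<xi> k, \<eta> k) (r k)) \<le> ennreal (C * \<eta> k powr (real DIM('a) * (q / p) + \<alpha> * q))"
  obtains K :: real where "0 \<le> K"
    "\<And>f :: 'a \<times> real \<Rightarrow> 'b::euclidean_space. harmonic_on f upper_half \<Longrightarrow>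
       (\<integral>\<^sup>+z. ennreal (norm (f z) powr q) \<partial>\<mu>) \<le>
       ennreal K * (\<integral>\<^sup>+t\<in>{0<..}. ennpowr (slice_norm p f t) q * ennreal (t powr (\<alpha> * q - 1)) \<partial>lborel)"
proof -
  let ?m = "q / p" and ?n = "real DIM('a)"
  let ?Q = "\<lambda>k. cube (\<xi> k, \<eta> k) (r k)" and ?R = "\<lambda>k. cube (\<xi> k, \<eta> k) (5 / 4 * r k)"
  have m: "1 \<le> ?m" using p pq by simp
  obtain c where c: "0 < c" and r: "\<And>k. 0 < r k" "\<And>k. r k \<le> \<eta> k" and \<eta>r: "\<And>k. \<eta> k \<le> c * r k"
    using whitney_side_comparable[OF W] by blast
  have \<eta>: "0 < \<eta> k" for k using r[of k] by linarith
  have R: "?R k \<subseteq> upper_half" for k using W by (simp add: whitney_decomposition_def)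
  have QR: "?Q k \<subseteq> ?R k" for k using r[of k] by (intro cube_mono) simp
  have union: "(\<Union>k. ?Q k) = upper_half" using W by (simp add: whitney_decomposition_def)
  obtain N where N: "\<And>z. finite {k. z \<in> ?R k}" "\<And>z. card {k. z \<in> ?R k} \<le> N"
    using W unfolding whitney_decomposition_def by metis
  obtain a b where ab: "0 < a" "0 < b" and t\<eta>: "\<And>k x t. (x, t) \<in> ?R k \<Longrightarrow> a * \<eta> k \<le> t \<and> t \<le> b * \<eta> k"
    using W unfolding whitney_decomposition_def by metis
  have sp: "space \<mu> = upper_half"
    using sets_eq_imp_space_eq[OF sets] by (simp add: space_restrict_space)
  have Qsets: "?Q k \<in> sets \<mu>" for k by (rule cube_in_sets_upper_half[OF W sets])
  let ?e = "\<alpha> * q - 1"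
  obtain K1 :: real where K1: "0 < K1" and sup:
    "\<And>(f :: 'a \<times> real \<Rightarrow> 'b) (\<xi> :: 'a) \<eta> r z.
       harmonic_on f upper_half \<Longrightarrow> 0 < r \<Longrightarrow> cube (\<xi>, \<eta>) (5 / 4 * r) \<subseteq> upper_half \<Longrightarrow> z \<in> cube (\<xi>, \<eta>) r \<Longrightarrow>
       ennreal (norm (f z) powr q) \<le> ennreal (K1 * r powr (- (?n * ?m) - 1)) *
         (\<integral>\<^sup>+t\<in>{t. \<bar>t - \<eta>\<bar> \<le> 5 / 4 * r}. ennpowr (\<integral>\<^sup>+x. ennreal (norm (f (x, t)) powr p) * indicator (cube (\<xi>, \<eta>) (5 / 4 * r)) (x, t) \<partial>lborel) ?m \<partial>lborel)"
    using harmonic_powr_le_on_cube[OF p pq] by blast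
  define K2 where "K2 = C * (K1 * c powr (?n * ?m + 1))"
  define K3 where "K3 = max (a powr (- ?e)) (b powr (- ?e))"
  have K23: "K2 \<ge> 0" "K3 \<ge> 0" using C K1 by (auto simp: K2_def K3_def le_max_iff_disj)
  show ?thesis
  proof (rule that[of "K2 * K3 * real N powr ?m"])
    show "0 \<le> K2 * K3 * real N powr ?m" using K23 by simp
    fix f :: "'a \<times> real \<Rightarrow> 'b" assume f: "harmonic_on f upper_half"
    note cf = harmonic_on_imp_continuous_on[OF f]
    define A where "A k t = (\<integral>\<^sup>+x. ennreal (norm (f (x, t)) powr p) * indicator (?R k) (x, t) \<partial>lborel)" for k t
    define S where "S t = (\<integral>\<^sup>+x. ennreal (norm (f (x, t)) powr p) \<partial>lborel)" for t
    have F_meas [measurable]: "(\<lambda>w. ennreal (norm (f w) powr p) * indicator (?R k) w) \<in> borel_measurable borel" for k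
      using continuous_on_subset[OF cf R[of k]] p by (intro borel_measurable_norm_powr_indicator) simp_all
    have A_meas [measurable]: "A k \<in> borel_measurable lborel" for k
      unfolding A_def by measurable
    have A_sum: "(\<Sum>k. A k t) \<le> of_nat N * S t" if "t > 0" for t
    proof -
      have ct: "continuous_on UNIV (\<lambda>x. f (x, t))"
        by (rule continuous_on_compose2[OF cf]) (use that in \<open>auto intro!: continuous_intros simp: upper_half_def\<close>)
      have [measurable]: "(\<lambda>x. f (x, t)) \<in> borel_measurable borel"
        using ct by (rule borel_measurable_continuous_onI)
      have [measurable]: "(\<lambda>x. indicator (?R k) (x, t) :: ennreal) \<in> borel_measurable borel" for k
      proof -
        have "?R k \<in> sets borel" by (intro borel_closed closed_cube)
        then show ?thesis by measurable
      qed
      have "(\<Sum>k. A k t) = (\<integral>\<^sup>+x. (\<Sum>k. ennreal (norm (f (x, t)) powr p) * indicator (?R k) (x, t)) \<partial>lborel)"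
        unfolding A_def by (rule nn_integral_suminf[symmetric]) measurable
      also have "\<dots> \<le> (\<integral>\<^sup>+x. of_nat N * ennreal (norm (f (x, t)) powr p) \<partial>lborel)"
      proof (rule nn_integral_mono)
        fix x
        show "(\<Sum>k. ennreal (norm (f (x, t)) powr p) * indicator (?R k) (x, t)) \<le> of_nat N * ennreal (norm (f (x, t)) powr p)"
          unfolding ennreal_suminf_cmult mult.commute[of "of_nat N"]
          by (intro mult_left_mono suminf_indicator_le_card N) simp
      qed
      also have "\<dots> = of_nat N * S t" unfolding S_def by (rule nn_integral_cmult) measurable
      finally show ?thesis .
    qed
    have cube_bound: "(\<integral>\<^sup>+z\<in>?Q k. ennreal (norm (f z) powr q) \<partial>\<mu>) \<le>
        ennreal (K2 * K3) * (\<integral>\<^sup>+t\<in>{0<..}. ennpowr (A k t) ?m * ennreal (t powr ?e) \<partial>lborel)" for k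
    proof -
      let ?T = "{t. \<bar>t - \<eta> k\<bar> \<le> 5 / 4 * r k}"
      let ?J = "\<integral>\<^sup>+t\<in>?T. ennpowr (A k t) ?m \<partial>lborel"
      let ?u = "K1 * r k powr (- (?n * ?m) - 1)"
      have "(\<integral>\<^sup>+z\<in>?Q k. ennreal (norm (f z) powr q) \<partial>\<mu>) \<le> (\<integral>\<^sup>+z. (ennreal ?u * ?J) * indicator (?Q k) z \<partial>\<mu>)"
        using sup[OF f r(1)[of k] R[of k]] unfolding A_def by (intro nn_integral_mono) (auto split: split_indicator)
      also have "\<dots> = ennreal ?u * ?J * emeasure \<mu> (?Q k)"
        using Qsets by (rule nn_integral_cmult_indicator)
      also have "\<dots> \<le> ennreal ?u * ?J * ennreal (C * \<eta> k powr (?n * ?m + \<alpha> * q))"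
        by (intro mult_left_mono bound) auto
      also have "\<dots> = ennreal (C * \<eta> k powr (?n * ?m + \<alpha> * q) * ?u) * ?J"
        using C K1 by (simp add: ennreal_mult ac_simps)
      also have "\<dots> \<le> ennreal (K2 * \<eta> k powr ?e) * ?J"
      proof (intro mult_right_mono ennreal_leI)
        have "r k powr (- (?n * ?m) - 1) \<le> (\<eta> k / c) powr (- (?n * ?m) - 1)"
        proof (rule powr_mono2')
          have "0 \<le> ?n * ?m" using p pq by simp
          then show "- (?n * ?m) - 1 \<le> 0" by simp
        qed (use \<eta>r[of k] \<eta>[of k] c in \<open>auto simp: field_simps\<close>)
        also have "\<dots> = c powr (?n * ?m + 1) * \<eta> k powr (- (?n * ?m) - 1)"
          using c \<eta>[of k] by (simp add: powr_divide powr_diff powr_minus powr_add field_simps)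
        finally have "C * \<eta> k powr (?n * ?m + \<alpha> * q) * ?u \<le>
            C * \<eta> k powr (?n * ?m + \<alpha> * q) * (K1 * (c powr (?n * ?m + 1) * \<eta> k powr (- (?n * ?m) - 1)))"
          using C K1 by (intro mult_left_mono) auto
        also have "\<dots> = K2 * (\<eta> k powr (?n * ?m + \<alpha> * q) * \<eta> k powr (- (?n * ?m) - 1))"
          by (simp add: K2_def)
        also have "\<dots> = K2 * \<eta> k powr ?e" by (simp flip: powr_add)
        finally show "C * \<eta> k powr (?n * ?m + \<alpha> * q) * ?u \<le> K2 * \<eta> k powr ?e" .
      qed simp
      also have "\<dots> = ennreal K2 * (\<integral>\<^sup>+t. ennreal (\<eta> k powr ?e) * (ennpowr (A k t) ?m * indicator ?T t) \<partial>lborel)"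
        using K23 by (subst nn_integral_cmult) (auto simp: ennreal_mult mult.assoc)
      also have "\<dots> \<le> ennreal K2 * (\<integral>\<^sup>+t. ennreal K3 * (ennpowr (A k t) ?m * ennreal (t powr ?e) * indicator {0<..} t) \<partial>lborel)"
      proof (intro mult_left_mono nn_integral_mono)
        fix t :: real
        show "ennreal (\<eta> k powr ?e) * (ennpowr (A k t) ?m * indicator ?T t) \<le>
            ennreal K3 * (ennpowr (A k t) ?m * ennreal (t powr ?e) * indicator {0<..} t)"
        proof (cases "t \<in> ?T")
          case True
          then have "(\<xi> k, t) \<in> ?R k" using r(1)[of k] by (simp add: mem_cube_Pair_iff) (simp add: mem_cube_iff)
          then have t: "a * \<eta> k \<le> t" "t \<le> b * \<eta> k" "0 < t" using t\<eta> R[of k] by (auto simp: upper_half_def)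
          have "ennreal (\<eta> k powr ?e) \<le> ennreal (K3 * t powr ?e)"
            unfolding K3_def using t ab \<eta> by (intro ennreal_leI powr_comparable_le)
          then have "ennreal (\<eta> k powr ?e) * ennpowr (A k t) ?m \<le> ennreal (K3 * t powr ?e) * ennpowr (A k t) ?m"
            by (rule mult_right_mono) simp
          then show ?thesis using t True K23 by (simp add: ennreal_mult ac_simps)
        qed simp
      qed simp
      also have "\<dots> = ennreal (K2 * K3) * (\<integral>\<^sup>+t\<in>{0<..}. ennpowr (A k t) ?m * ennreal (t powr ?e) \<partial>lborel)"
        using K23 by (subst nn_integral_cmult) (auto simp: ennreal_mult mult.assoc)
      finally show ?thesis .
    qed
    have fq_meas [measurable]: "(\<lambda>z. ennreal (norm (f z) powr q)) \<in> borel_measurable \<mu>"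
    proof -
      have "f \<in> borel_measurable (restrict_space borel upper_half)"
        by (rule borel_measurable_continuous_on_restrict[OF cf])
      then have [measurable]: "f \<in> borel_measurable \<mu>" using measurable_cong_sets[OF sets refl] by blast
      show ?thesis by measurable
    qed
    note Qsets [measurable]
    have "(\<integral>\<^sup>+z. ennreal (norm (f z) powr q) \<partial>\<mu>) \<le> (\<integral>\<^sup>+z. (\<Sum>k. ennreal (norm (f z) powr q) * indicator (?Q k) z) \<partial>\<mu>)"
    proof (rule nn_integral_mono)
      fix z assume "z \<in> space \<mu>"
      then obtain k where "z \<in> ?Q k" using union sp by blast
      then have "ennreal (norm (f z) powr q) = (\<Sum>k\<in>{k}. ennreal (norm (f z) powr q) * indicator (?Q k) z)" by simp
      also have "\<dots> \<le> (\<Sum>k. ennreal (norm (f z) powr q) * indicator (?Q k) z)" by (rule sum_le_suminf) auto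
      finally show "ennreal (norm (f z) powr q) \<le> (\<Sum>k. ennreal (norm (f z) powr q) * indicator (?Q k) z)" .
    qed
    also have "\<dots> = (\<Sum>k. \<integral>\<^sup>+z\<in>?Q k. ennreal (norm (f z) powr q) \<partial>\<mu>)"
      by (rule nn_integral_suminf) measurable
    also have "\<dots> \<le> (\<Sum>k. ennreal (K2 * K3) * (\<integral>\<^sup>+t\<in>{0<..}. ennpowr (A k t) ?m * ennreal (t powr ?e) \<partial>lborel))"
      by (intro suminf_le cube_bound) auto
    also have "\<dots> = ennreal (K2 * K3) * (\<Sum>k. \<integral>\<^sup>+t\<in>{0<..}. ennpowr (A k t) ?m * ennreal (t powr ?e) \<partial>lborel)"
      by simp
    also have "(\<Sum>k. \<integral>\<^sup>+t\<in>{0<..}. ennpowr (A k t) ?m * ennreal (t powr ?e) \<partial>lborel) =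
        (\<integral>\<^sup>+t. (\<Sum>k. ennpowr (A k t) ?m * ennreal (t powr ?e) * indicator {0<..} t) \<partial>lborel)"
      by (rule nn_integral_suminf[symmetric]) measurable
    also have "\<dots> \<le> (\<integral>\<^sup>+t\<in>{0<..}. ennpowr (of_nat N * S t) ?m * ennreal (t powr ?e) \<partial>lborel)"
    proof (rule nn_integral_mono)
      fix t :: real
      have "(\<Sum>k. ennpowr (A k t) ?m) \<le> ennpowr (of_nat N * S t) ?m" if "t > 0"
        using suminf_ennpowr_le[OF m] ennpowr_mono[OF A_sum[OF that], of ?m] m by (meson order_trans zero_le_one)
      then show "(\<Sum>k. ennpowr (A k t) ?m * ennreal (t powr ?e) * indicator {0<..} t) \<le>
          ennpowr (of_nat N * S t) ?m * ennreal (t powr ?e) * indicator {0<..} t"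
        by (auto intro!: mult_right_mono split: split_indicator)
    qed
    also have "\<dots> = (\<integral>\<^sup>+t. ennreal (real N powr ?m) * (ennpowr (slice_norm p f t) q * ennreal (t powr ?e) * indicator {0<..} t) \<partial>lborel)"
      using p by (simp add: ennpowr_mult ennpowr_slice_norm S_def ennreal_of_nat_eq_real_of_nat ennpowr_ennreal mult.assoc)
    also have "\<dots> = ennreal (real N powr ?m) * (\<integral>\<^sup>+t\<in>{0<..}. ennpowr (slice_norm p f t) q * ennreal (t powr ?e) \<partial>lborel)"
    proof (rule nn_integral_cmult)
      have cm: "(\<lambda>w. indicator upper_half w *\<^sub>R f w) \<in> borel_measurable borel"
        by (rule borel_measurable_continuous_on_indicator[OF _ cf]) (simp add: open_upper_half)
      have [measurable]: "(\<lambda>t. \<integral>\<^sup>+x. ennreal (norm (indicator upper_half (x, t) *\<^sub>R f (x, t)) powr p) \<partial>lborel) \<in> borel_measurable lborel"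
        using cm by measurable
      have "(\<lambda>t. ennpowr (\<integral>\<^sup>+x. ennreal (norm (indicator upper_half (x, t) *\<^sub>R f (x, t)) powr p) \<partial>lborel) ?m * ennreal (t powr ?e) * indicator {0<..} t) \<in> borel_measurable lborel"
        by measurable
      also have "(\<lambda>t. ennpowr (\<integral>\<^sup>+x. ennreal (norm (indicator upper_half (x, t) *\<^sub>R f (x, t)) powr p) \<partial>lborel) ?m * ennreal (t powr ?e) * indicator {0<..} t) =
          (\<lambda>t. ennpowr (slice_norm p f t) q * ennreal (t powr ?e) * indicator {0<..} t)"
        using p by (auto simp: fun_eq_iff ennpowr_slice_norm upper_half_def split: split_indicator)
      finally show "(\<lambda>t. ennpowr (slice_norm p f t) q * ennreal (t powr ?e) * indicator {0<..} t) \<in> borel_measurable lborel" .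
    qed
    finally show "(\<integral>\<^sup>+z. ennreal (norm (f z) powr q) \<partial>\<mu>) \<le>
       ennreal (K2 * K3 * real N powr ?m) * (\<integral>\<^sup>+t\<in>{0<..}. ennpowr (slice_norm p f t) q * ennreal (t powr ?e) \<partial>lborel)"
      using K23 by (simp add: ennreal_mult mult.assoc mult_left_mono)
  qed
qed

lemma carleson_condition_imp_embedding:
  fixes p q \<alpha> :: real and \<xi> :: "nat \<Rightarrow> 'a::euclidean_space" and \<mu> :: "('a \<times> real) measure"
  assumes p: "0 < p" and pq: "p \<le> q"
    and W: "whitney_decomposition \<xi> \<eta> r"
    and sets: "sets \<mu> = sets (restrict_space borel upper_half)"
    and C: "0 \<le> C"
    and bound: "\<And>k. emeasure \<mu> (cube (\<xi> k, \<eta> k) (r k)) \<le> ennreal (C * \<eta> k powr (real DIM('a) * (q / p) + \<alpha> * q))"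
  shows "continuous_embedding (B_space q p \<alpha> :: ('a \<times> real \<Rightarrow> 'b::euclidean_space) set)
           (B_norm q p \<alpha>) (Lp_space q \<mu>) (Lp_norm q \<mu>)"
proof -
  have q: "0 < q" using p pq by simp
  obtain K :: real where K: "0 \<le> K" and le:
    "\<And>f :: 'a \<times> real \<Rightarrow> 'b. harmonic_on f upper_half \<Longrightarrow>
       (\<integral>\<^sup>+z. ennreal (norm (f z) powr q) \<partial>\<mu>) \<le>
       ennreal K * (\<integral>\<^sup>+t\<in>{0<..}. ennpowr (slice_norm p f t) q * ennreal (t powr (\<alpha> * q - 1)) \<partial>lborel)"
    using carleson_condition_imp_norm_bound[OF p pq W sets C bound] by blast
  have norm_le: "Lp_norm q \<mu> f \<le> ennreal (K powr (1 / q)) * B_norm q p \<alpha> f"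
    if "f \<in> (B_space q p \<alpha> :: ('a \<times> real \<Rightarrow> 'b) set)" for f
  proof -
    have "Lp_norm q \<mu> f \<le> ennpowr (ennreal K * (\<integral>\<^sup>+t\<in>{0<..}. ennpowr (slice_norm p f t) q * ennreal (t powr (\<alpha> * q - 1)) \<partial>lborel)) (1 / q)"
      unfolding Lp_norm_def using that q by (intro ennpowr_mono le) (auto simp: B_space_def)
    then show ?thesis using K by (simp add: ennpowr_mult ennpowr_ennreal B_norm_def)
  qed
  show ?thesis
    unfolding continuous_embedding_def
  proof (intro conjI subsetI exI[of _ "K powr (1 / q)"] ballI norm_le)
    fix f assume f: "f \<in> (B_space q p \<alpha> :: ('a \<times> real \<Rightarrow> 'b) set)"
    then have "f \<in> borel_measurable (restrict_space borel upper_half)"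
      by (intro borel_measurable_continuous_on_restrict harmonic_on_imp_continuous_on) (simp add: B_space_def)
    then have "f \<in> borel_measurable \<mu>" using measurable_cong_sets[OF sets refl] by blast
    moreover have "Lp_norm q \<mu> f < top"
      using norm_le[OF f] by (rule le_less_trans) (use f in \<open>simp add: B_space_def ennreal_mult_less_top\<close>)
    ultimately show "f \<in> Lp_space q \<mu>" by (simp add: Lp_space_def)
  qed simp_all
qed

section \<open>Rapidly decaying harmonic functions and the necessity of the measure condition\<close>

lemma ennreal_le_suminf: "(f j :: ennreal) \<le> (\<Sum>j. f j)"
  using sum_le_suminf[of f "{j}"] by simp

text \<open>Splitting into the dyadic shells between the radii \<open>2 ^ j * \<tau>\<close> and \<open>2 ^ Suc j * \<tau>\<close> gives a geometric
  series of ratio \<open>\<theta>\<close>, and at once the right dependence on \<open>\<tau>\<close>.\<close>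
lemma nn_integral_max_norm_powr_le:
  fixes P :: real
  assumes P: "real DIM('a::euclidean_space) < P"
  obtains C where "0 < C"
    "\<And>(\<xi> :: 'a) \<tau>. 0 < \<tau> \<Longrightarrow>
       (\<integral>\<^sup>+x. ennreal (max (norm (x - \<xi>)) \<tau> powr (- P)) \<partial>lborel) \<le> ennreal (C * \<tau> powr (real DIM('a) - P))"
proof -
  let ?n = "DIM('a)"
  let ?v = "unit_ball_vol (real ?n)"
  define \<theta> where "\<theta> = 2 powr (real ?n - P)"
  have \<theta>: "0 < \<theta>" "\<theta> < 1" using P by (auto simp: \<theta>_def powr_less_one)
  define C where "C = ?v * 2 ^ ?n * (1 / (1 - \<theta>))"
  show ?thesis
  proof (rule that[of C])
    show "0 < C" using \<theta> by (simp add: C_def)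
    fix \<xi> :: 'a and \<tau> :: real assume \<tau>: "0 < \<tau>"
    have shell: "ennreal (max (norm (x - \<xi>)) \<tau> powr (- P)) \<le>
        (\<Sum>j. ennreal ((2 ^ j * \<tau>) powr (- P)) * indicator (cball \<xi> (2 ^ Suc j * \<tau>)) x)" for x
    proof -
      define y where "y = max (norm (x - \<xi>)) \<tau>"
      have y: "\<tau> \<le> y" "norm (x - \<xi>) \<le> y" by (auto simp: y_def)
      obtain i where i: "y / \<tau> < 2 ^ i" using real_arch_pow[of 2 "y / \<tau>"] by auto
      define l where "l = (LEAST i. y / \<tau> < 2 ^ i)"
      have l: "y / \<tau> < 2 ^ l" unfolding l_def by (rule LeastI[of _ i]) (rule i)
      have "l \<noteq> 0" using l y \<tau> by (intro notI) simp
      then obtain j where j: "l = Suc j" by (cases l) auto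
      have "\<not> y / \<tau> < 2 ^ j" using not_less_Least[of j "\<lambda>i. y / \<tau> < 2 ^ i"] j by (simp add: l_def)
      then have lo: "2 ^ j * \<tau> \<le> y" using \<tau> by (simp add: field_simps)
      have hi: "y \<le> 2 ^ Suc j * \<tau>" using l \<tau> j by (simp add: field_simps)
      have x: "x \<in> cball \<xi> (2 ^ Suc j * \<tau>)" using y hi by (simp add: dist_norm norm_minus_commute)
      have "ennreal (y powr (- P)) \<le> ennreal ((2 ^ j * \<tau>) powr (- P)) * indicator (cball \<xi> (2 ^ Suc j * \<tau>)) x"
        using x lo \<tau> P by (auto intro!: ennreal_leI powr_mono2')
      also have "\<dots> \<le> (\<Sum>j. ennreal ((2 ^ j * \<tau>) powr (- P)) * indicator (cball \<xi> (2 ^ Suc j * \<tau>)) x)"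
        by (rule ennreal_le_suminf)
      finally show ?thesis by (simp add: y_def)
    qed
    have "(\<integral>\<^sup>+x. ennreal (max (norm (x - \<xi>)) \<tau> powr (- P)) \<partial>lborel) \<le>
        (\<integral>\<^sup>+x. (\<Sum>j. ennreal ((2 ^ j * \<tau>) powr (- P)) * indicator (cball \<xi> (2 ^ Suc j * \<tau>)) x) \<partial>lborel)"
      by (intro nn_integral_mono shell)
    also have "\<dots> = (\<Sum>j. \<integral>\<^sup>+x. ennreal ((2 ^ j * \<tau>) powr (- P)) * indicator (cball \<xi> (2 ^ Suc j * \<tau>)) x \<partial>lborel)"
      by (intro nn_integral_suminf borel_measurable_times_ennreal borel_measurable_const borel_measurable_indicator) simp
    also have "\<dots> = (\<Sum>j. ennreal (?v * 2 ^ ?n * \<tau> powr (real ?n - P) * \<theta> ^ j))"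
    proof (rule suminf_cong)
      fix j
      have "(\<integral>\<^sup>+x. ennreal ((2 ^ j * \<tau>) powr (- P)) * indicator (cball \<xi> (2 ^ Suc j * \<tau>)) x \<partial>lborel) =
          ennreal ((2 ^ j * \<tau>) powr (- P)) * ennreal (?v * (2 ^ Suc j * \<tau>) ^ ?n)"
        using \<tau> by (subst nn_integral_cmult_indicator) (auto simp: emeasure_cball)
      also have "\<dots> = ennreal ((2 ^ j * \<tau>) powr (- P) * (?v * (2 ^ Suc j * \<tau>) ^ ?n))"
        by (simp add: ennreal_mult')
      also have "(2 ^ j * \<tau>) powr (- P) * (?v * (2 ^ Suc j * \<tau>) ^ ?n) = ?v * 2 ^ ?n * (2 ^ j * \<tau>) powr (real ?n - P)"
        using \<tau> by (simp add: powr_diff powr_minus_divide powr_realpow power_mult_distrib)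
      also have "(2 ^ j * \<tau>) powr (real ?n - P) = \<tau> powr (real ?n - P) * \<theta> ^ j"
        using \<tau> by (simp add: powr_mult \<theta>_def powr_powr mult.commute flip: powr_realpow)
      finally show "(\<integral>\<^sup>+x. ennreal ((2 ^ j * \<tau>) powr (- P)) * indicator (cball \<xi> (2 ^ Suc j * \<tau>)) x \<partial>lborel) =
        ennreal (?v * 2 ^ ?n * \<tau> powr (real ?n - P) * \<theta> ^ j)" by (simp add: mult.assoc)
    qed
    also have "\<dots> = ennreal (\<Sum>j. ?v * 2 ^ ?n * \<tau> powr (real ?n - P) * \<theta> ^ j)"
      using \<theta> by (intro suminf_ennreal2 summable_mult summable_geometric) auto
    also have "(\<Sum>j. ?v * 2 ^ ?n * \<tau> powr (real ?n - P) * \<theta> ^ j) = ?v * 2 ^ ?n * \<tau> powr (real ?n - P) * (1 / (1 - \<theta>))"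
      using \<theta> by (subst suminf_mult) (auto simp: summable_geometric suminf_geometric)
    also have "\<dots> = C * \<tau> powr (real ?n - P)" by (simp add: C_def)
    finally show "(\<integral>\<^sup>+x. ennreal (max (norm (x - \<xi>)) \<tau> powr (- P)) \<partial>lborel) \<le> ennreal (C * \<tau> powr (real ?n - P))" .
  qed
qed

text \<open>Below \<open>\<eta>\<close> the weight \<open>t powr (\<beta> - 1)\<close> is integrable because \<open>0 < \<beta>\<close>, above \<open>\<eta>\<close> the product is
  integrable because \<open>\<beta> < Q\<close>.\<close>
lemma nn_integral_max_powr_le:
  fixes \<beta> Q :: real
  assumes \<beta>: "0 < \<beta>" and Q: "\<beta> < Q"
  obtains C where "0 < C"
    "\<And>\<eta>. 0 < \<eta> \<Longrightarrow>
       (\<integral>\<^sup>+t\<in>{0<..}. ennreal (max t \<eta> powr (- Q)) * ennreal (t powr (\<beta> - 1)) \<partial>lborel) \<le> ennreal (C * \<eta> powr (\<beta> - Q))"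
proof (rule that[of "1 / \<beta> + 1 / (Q - \<beta>)"])
  show "0 < 1 / \<beta> + 1 / (Q - \<beta>)" using \<beta> Q by (intro add_pos_pos) auto
  fix \<eta> :: real assume \<eta>: "0 < \<eta>"
  have sum_eq: "(1 / \<beta> + 1 / (Q - \<beta>)) * \<eta> powr (\<beta> - Q) = \<eta> powr (- Q) * (\<eta> powr \<beta> / \<beta>) + \<eta> powr (\<beta> - Q) / (Q - \<beta>)"
    by (simp add: algebra_simps powr_diff powr_minus_divide add_divide_distrib)
  have 1: "(\<integral>\<^sup>+t. ennreal (t powr (\<beta> - 1)) * indicator {0..\<eta>} t \<partial>lborel) = ennreal (\<eta> powr \<beta> / \<beta>)"
    using has_integral_powr_from_0[of "\<beta> - 1" \<eta>] \<beta> \<eta> by (intro nn_integral_has_integral_lebesgue') auto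
  have 2: "(\<integral>\<^sup>+t. ennreal (t powr (\<beta> - 1 - Q)) * indicator {\<eta>..} t \<partial>lborel) = ennreal (\<eta> powr (\<beta> - Q) / (Q - \<beta>))"
  proof (rule nn_integral_has_integral_lebesgue')
    have "- (\<eta> powr (\<beta> - 1 - Q + 1)) / (\<beta> - 1 - Q + 1) = \<eta> powr (\<beta> - Q) / (Q - \<beta>)"
      using Q by (simp add: field_simps)
    then show "((\<lambda>t. t powr (\<beta> - 1 - Q)) has_integral \<eta> powr (\<beta> - Q) / (Q - \<beta>)) {\<eta>..}"
      using has_integral_powr_to_inf[of "\<beta> - 1 - Q" \<eta>] Q \<eta> by simp
  qed simp
  have "(\<integral>\<^sup>+t\<in>{0<..}. ennreal (max t \<eta> powr (- Q)) * ennreal (t powr (\<beta> - 1)) \<partial>lborel) \<le>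
      (\<integral>\<^sup>+t. ennreal (\<eta> powr (- Q)) * (ennreal (t powr (\<beta> - 1)) * indicator {0..\<eta>} t) +
        ennreal (t powr (\<beta> - 1 - Q)) * indicator {\<eta>..} t \<partial>lborel)"
  proof (rule nn_integral_mono)
    fix t :: real
    consider "t \<le> 0" | "0 < t" "t \<le> \<eta>" | "\<eta> < t" by linarith
    then show "ennreal (max t \<eta> powr (- Q)) * ennreal (t powr (\<beta> - 1)) * indicator {0<..} t \<le>
       ennreal (\<eta> powr (- Q)) * (ennreal (t powr (\<beta> - 1)) * indicator {0..\<eta>} t) +
        ennreal (t powr (\<beta> - 1 - Q)) * indicator {\<eta>..} t"
    proof cases
      case 3
      then have "t powr (- Q) * t powr (\<beta> - 1) = t powr (\<beta> - 1 - Q)"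
        by (simp add: algebra_simps flip: powr_add)
      then show ?thesis using 3 \<eta> by (auto simp: max_def simp flip: ennreal_mult)
    qed (auto simp: max_def)
  qed
  also have "\<dots> = ennreal (\<eta> powr (- Q)) * ennreal (\<eta> powr \<beta> / \<beta>) + ennreal (\<eta> powr (\<beta> - Q) / (Q - \<beta>))"
    by (simp add: nn_integral_add nn_integral_cmult 1 2)
  also have "\<dots> = ennreal ((1 / \<beta> + 1 / (Q - \<beta>)) * \<eta> powr (\<beta> - Q))"
    unfolding sum_eq using \<beta> Q by (simp flip: ennreal_mult ennreal_plus)
  finally show "(\<integral>\<^sup>+t\<in>{0<..}. ennreal (max t \<eta> powr (- Q)) * ennreal (t powr (\<beta> - 1)) \<partial>lborel) \<le>
      ennreal ((1 / \<beta> + 1 / (Q - \<beta>)) * \<eta> powr (\<beta> - Q))" by simp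
qed

definition plane_coord :: "'a::euclidean_space \<Rightarrow> 'a \<Rightarrow> 'a \<Rightarrow> complex" where
  "plane_coord e1 e2 z = complex_of_real (z \<bullet> e1) + \<i> * complex_of_real (z \<bullet> e2)"

text \<open>The Kelvin transform of the harmonic polynomial \<open>z \<mapsto> Re (plane_coord e1 e2 z ^ m)\<close>, homogeneous of
  degree \<open>2 - m - d\<close> in dimension \<open>d\<close>.  Large \<open>m\<close> gives harmonic functions decaying as fast as
  desired.\<close>
definition kelvin_plane_power :: "nat \<Rightarrow> 'a::euclidean_space \<Rightarrow> 'a \<Rightarrow> 'a \<Rightarrow> real" where
  "kelvin_plane_power m e1 e2 z = Re (plane_coord e1 e2 z ^ m) * (z \<bullet> z) powr (1 - real m - real DIM('a) / 2)"

lemma norm_plane_coord_le: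
  assumes "e1 \<in> Basis" "e2 \<in> Basis" "e1 \<noteq> e2"
  shows "norm (plane_coord e1 e2 z) \<le> norm z"
proof -
  have "(z \<bullet> e1)\<^sup>2 + (z \<bullet> e2)\<^sup>2 = (\<Sum>b\<in>{e1, e2}. (z \<bullet> b)\<^sup>2)" using assms by simp
  also have "\<dots> \<le> (\<Sum>b\<in>Basis. (z \<bullet> b)\<^sup>2)" using assms by (intro sum_mono2) auto
  also have "\<dots> = z \<bullet> z" by (subst euclidean_inner[of z z]) (simp add: power2_eq_square)
  also have "\<dots> = (norm z)\<^sup>2" by (simp add: power2_norm_eq_inner)
  finally have "(norm (plane_coord e1 e2 z))\<^sup>2 \<le> (norm z)\<^sup>2" by (simp add: plane_coord_def cmod_power2)
  then show ?thesis by (rule power2_le_imp_le) simp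
qed

lemma bounded_linear_plane_coord: "bounded_linear (plane_coord e1 e2)"
  unfolding linear_conv_bounded_linear[symmetric]
  by (rule linearI) (auto simp: plane_coord_def inner_simps algebra_simps complex_eq_iff)

lemma sum_Basis_plane_coord_squared:
  assumes "e1 \<in> Basis" "e2 \<in> Basis" "e1 \<noteq> e2"
  shows "(\<Sum>u\<in>Basis. (plane_coord e1 e2 u)\<^sup>2) = 0"
proof -
  have "(plane_coord e1 e2 u)\<^sup>2 = (if u = e1 then 1 else 0) - (if u = e2 then 1 else 0)" if "u \<in> Basis" for u
    using assms that by (auto simp: plane_coord_def inner_Basis power2_eq_square)
  then have "(\<Sum>u\<in>Basis. (plane_coord e1 e2 u)\<^sup>2) = (\<Sum>u\<in>Basis. (if u = e1 then 1 else 0) - (if u = e2 then 1 else 0))"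
    by (intro sum.cong) auto
  also have "\<dots> = 0" using assms by (simp add: sum_subtractf)
  finally show ?thesis .
qed

lemma sum_Basis_inner_plane_coord:
  "(\<Sum>u\<in>Basis. (w \<bullet> u) *\<^sub>R plane_coord e1 e2 u) = plane_coord e1 e2 w"
proof -
  interpret bounded_linear "plane_coord e1 e2" by (rule bounded_linear_plane_coord)
  have "plane_coord e1 e2 (\<Sum>u\<in>Basis. (w \<bullet> u) *\<^sub>R u) = (\<Sum>u\<in>Basis. (w \<bullet> u) *\<^sub>R plane_coord e1 e2 u)"
    by (simp add: sum scaleR)
  then show ?thesis by (simp add: euclidean_representation)
qed


text \<open>With \<open>Re p0\<close> the polynomial factor and \<open>q0 = |w| powr (2 * \<kappa>)\<close>, the Laplacian of the product is
  \<open>Re p0\<close> times \<open>\<kappa> * |w| powr (2 * \<kappa> - 2) * (4 * (\<kappa> - 1) + 2 * d + 4 * m)\<close>: the Laplacian of \<open>Re p0\<close>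
  vanishes because \<open>1\<^sup>2 + \<i>\<^sup>2 = 0\<close>, and Euler's identity for homogeneous functions evaluates the mixed term.
  The exponent \<open>\<kappa> = 1 - m - d / 2\<close> is chosen to make the last factor 0.\<close>
lemma harmonic_on_kelvin_plane_power:
  fixes e1 e2 c :: "'a::euclidean_space"
  assumes S: "open S" "c \<notin> S" and e: "e1 \<in> Basis" "e2 \<in> Basis" "e1 \<noteq> e2"
  shows "harmonic_on (\<lambda>z. of_real (kelvin_plane_power m e1 e2 (z - c)) :: 'b::real_normed_field) S"
proof -
  define L where "L = plane_coord e1 e2"
  define \<kappa> where "\<kappa> = 1 - real m - real DIM('a) / 2"
  \<comment> \<open>The factors, followed by their first and second derivatives in the directions \<open>u\<close> and \<open>v\<close>.\<close>
  define p0 where "p0 w = L w ^ m" for w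
  define p1 where "p1 w u = of_nat m * L w ^ (m - 1) * L u" for w u
  define p2 where "p2 w u v = of_nat m * (of_nat (m - 1) * L w ^ (m - 1 - 1)) * L v * L u" for w u v
  define q0 where "q0 w = (w \<bullet> w) powr \<kappa>" for w :: 'a
  define q1 where "q1 w u = \<kappa> * (w \<bullet> w) powr (\<kappa> - 1) * (2 * (w \<bullet> u))" for w u :: 'a
  define q2 where "q2 w u v = \<kappa> * ((\<kappa> - 1) * (w \<bullet> w) powr (\<kappa> - 1 - 1) * (2 * (w \<bullet> v))) * (2 * (w \<bullet> u))
      + \<kappa> * (w \<bullet> w) powr (\<kappa> - 1) * (2 * (v \<bullet> u))" for w u v :: 'a
  define G1 where "G1 w u = Re (p0 w) * q1 w u + Re (p1 w u) * q0 w" for w u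
  define G2 where "G2 w u v = (Re (p0 w) * q2 w u v + Re (p1 w v) * q1 w u) + (Re (p1 w u) * q1 w v + Re (p2 w u v) * q0 w)" for w u v
  have L: "(L has_derivative L) (at z)" for z
    unfolding L_def by (rule bounded_linear_imp_has_derivative[OF bounded_linear_plane_coord])
  have Lpow: "((\<lambda>z. L z ^ k) has_derivative (\<lambda>v. of_nat k * L z ^ (k - 1) * L v)) (at z)" for k z
    by (rule has_derivative_eq_rhs[OF has_derivative_power[OF L]]) (simp add: fun_eq_iff ac_simps)
  have p0': "((\<lambda>z. Re (p0 z)) has_derivative (\<lambda>v. Re (p1 z v))) (at z)" for z
    unfolding p0_def p1_def by (rule bounded_linear.has_derivative[OF bounded_linear_Re Lpow])
  have p1': "((\<lambda>z. Re (p1 z u)) has_derivative (\<lambda>v. Re (p2 z u v))) (at z)" for z u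
    unfolding p1_def p2_def
    by (rule bounded_linear.has_derivative[OF bounded_linear_Re], rule has_derivative_eq_rhs,
        rule has_derivative_mult_left, rule has_derivative_mult_right, rule Lpow) (simp add: fun_eq_iff mult.assoc)
  have powr': "((\<lambda>w::'a. (w \<bullet> w) powr k) has_derivative (\<lambda>v. k * (z \<bullet> z) powr (k - 1) * (2 * (z \<bullet> v)))) (at z)"
    if "z \<noteq> 0" for z k
  proof -
    have "((\<lambda>x. x powr k) has_derivative (\<lambda>h. k * (z \<bullet> z) powr (k - 1) * h)) (at (z \<bullet> z))"
      using has_real_derivative_powr[of "z \<bullet> z" k] that by (simp add: has_field_derivative_def)
    moreover have "((\<lambda>w. w \<bullet> w) has_derivative (\<lambda>v. 2 * (z \<bullet> v))) (at z)"
      by (rule has_derivative_eq_rhs, rule derivative_intros, (rule derivative_intros)+) (auto simp: fun_eq_iff inner_commute)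
    ultimately show ?thesis by (rule has_derivative_compose[rotated])
  qed
  have q0': "(q0 has_derivative (\<lambda>v. q1 z v)) (at z)" if "z \<noteq> 0" for z
    unfolding q0_def[abs_def] q1_def by (rule powr'[OF that])
  have q1': "((\<lambda>z. q1 z u) has_derivative (\<lambda>v. q2 z u v)) (at z)" if "z \<noteq> 0" for z u
    unfolding q1_def q2_def
    by (rule has_derivative_eq_rhs, rule has_derivative_mult, rule has_derivative_mult_right, rule powr'[OF that],
        rule has_derivative_mult_right, rule has_derivative_inner_left, rule has_derivative_ident) (simp add: fun_eq_iff)
  have G0': "((\<lambda>z. kelvin_plane_power m e1 e2 z) has_derivative (\<lambda>v. G1 z v)) (at z)" if "z \<noteq> 0" for z
    unfolding kelvin_plane_power_def G1_def p0_def[symmetric] q0_def[symmetric] \<kappa>_def[symmetric] L_def[symmetric]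
    by (rule has_derivative_mult[OF p0' q0'[OF that]])
  have G1': "((\<lambda>z. G1 z u) has_derivative (\<lambda>v. G2 z u v)) (at z)" if "z \<noteq> 0" for z u
    unfolding G1_def G2_def
    by (intro has_derivative_add has_derivative_mult p0' p1' q0' q1' that)
  have shift: "((\<lambda>z. of_real (g (z - c)) :: 'b) has_derivative (\<lambda>v. of_real (g' v))) (at z)"
    if "(g has_derivative g') (at (z - c))" for g g' z
  proof (rule has_derivative_of_real)
    have "((\<lambda>z. z - c) has_derivative (\<lambda>v. v)) (at z)"
      by (auto intro!: derivative_eq_intros)
    then have "((\<lambda>z. g (z - c)) has_derivative (\<lambda>v. g' v)) (at z)"
      by (rule has_derivative_compose[where f="\<lambda>z. z - c" and g=g]) (rule that)
    then show "((\<lambda>z. g (z - c)) has_derivative g') (at z)" by simp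
  qed
  have ne: "z - c \<noteq> 0" if "z \<in> S" for z using that S by auto
  have laplace: "(\<Sum>u\<in>Basis. G2 w u u) = 0" if w: "w \<noteq> 0" for w
  proof -
    have ww: "w \<bullet> w > 0" using w by simp
    have sum_inner: "(\<Sum>u\<in>Basis. (w \<bullet> u) * (w \<bullet> u)) = w \<bullet> w" by (rule euclidean_inner[symmetric])
    have sum_cross: "(\<Sum>u\<in>Basis. Re (p1 w u) * (w \<bullet> u)) = real m * Re (p0 w)"
    proof -
      have "(\<Sum>u\<in>Basis. Re (p1 w u) * (w \<bullet> u)) = Re (of_nat m * L w ^ (m - 1) * (\<Sum>u\<in>Basis. (w \<bullet> u) *\<^sub>R L u))"
        unfolding p1_def sum_distrib_left Re_sum by (intro sum.cong refl) (simp add: algebra_simps)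
      also have "\<dots> = Re (of_nat m * p0 w)"
        unfolding L_def sum_Basis_inner_plane_coord by (cases m) (simp_all add: p0_def L_def ac_simps)
      finally show ?thesis by simp
    qed
    have sum_p2: "(\<Sum>u\<in>Basis. Re (p2 w u u)) = 0"
    proof -
      have "(\<Sum>u\<in>Basis. Re (p2 w u u)) = Re (of_nat m * (of_nat (m - 1) * L w ^ (m - 1 - 1)) * (\<Sum>u\<in>Basis. (L u)\<^sup>2))"
        unfolding p2_def sum_distrib_left Re_sum by (simp only: power2_eq_square mult.assoc)
      then show ?thesis using sum_Basis_plane_coord_squared[OF e] by (simp add: L_def)
    qed
    define A where "A = Re (p0 w) * (\<kappa> * (\<kappa> - 1) * 4 * (w \<bullet> w) powr (\<kappa> - 1 - 1))"
    define B where "B = Re (p0 w) * (2 * \<kappa> * (w \<bullet> w) powr (\<kappa> - 1))"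
    define D where "D = 4 * \<kappa> * (w \<bullet> w) powr (\<kappa> - 1)"
    have "G2 w u u = A * ((w \<bullet> u) * (w \<bullet> u)) + B + D * (Re (p1 w u) * (w \<bullet> u)) + q0 w * Re (p2 w u u)"
      if "u \<in> Basis" for u
      using that by (simp add: G2_def q1_def q2_def A_def B_def D_def algebra_simps)
    then have "(\<Sum>u\<in>Basis. G2 w u u) = A * (\<Sum>u\<in>Basis. (w \<bullet> u) * (w \<bullet> u)) + B * real DIM('a)
        + D * (\<Sum>u\<in>Basis. Re (p1 w u) * (w \<bullet> u)) + q0 w * (\<Sum>u\<in>Basis. Re (p2 w u u))"
      by (simp add: sum.distrib sum_distrib_left)
    also have "\<dots> = Re (p0 w) * (\<kappa> * (w \<bullet> w) powr (\<kappa> - 1) * (4 * (\<kappa> - 1) + 2 * real DIM('a) + 4 * real m))"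
    proof -
      have "(w \<bullet> w) powr (\<kappa> - 1 - 1) * (w \<bullet> w) = (w \<bullet> w) powr (\<kappa> - 1)"
        using ww by (simp add: powr_diff power2_eq_square)
      then have "A * (w \<bullet> w) = Re (p0 w) * (\<kappa> * (\<kappa> - 1) * 4 * (w \<bullet> w) powr (\<kappa> - 1))"
        unfolding A_def by (simp only: mult.assoc)
      then show ?thesis unfolding sum_inner sum_cross sum_p2 B_def D_def
        by (simp add: algebra_simps)
    qed
    also have "4 * (\<kappa> - 1) + 2 * real DIM('a) + 4 * real m = 0" by (simp add: \<kappa>_def field_simps)
    finally show ?thesis by simp
  qed
  have cont: "continuous_on S (\<lambda>z. of_real (G2 (z - c) u v) :: 'b)" for u v
    unfolding G2_def p0_def p1_def p2_def q0_def q1_def q2_def L_def plane_coord_def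
    by (intro continuous_intros) (use ne in auto)
  show ?thesis
    unfolding harmonic_on_def
  proof (intro conjI exI[of _ "\<lambda>z v. of_real (G1 (z - c) v)"] exI[of _ "\<lambda>z u v. of_real (G2 (z - c) u v)"] ballI)
    show "open S" by (rule S)
  next
    fix z assume "z \<in> S"
    then show "((\<lambda>z. of_real (kelvin_plane_power m e1 e2 (z - c)) :: 'b) has_derivative (\<lambda>v. of_real (G1 (z - c) v))) (at z)"
      by (intro shift G0' ne)
  next
    fix z u :: 'a assume "z \<in> S"
    then show "((\<lambda>w. of_real (G1 (w - c) u) :: 'b) has_derivative (\<lambda>v. of_real (G2 (z - c) u v))) (at z)"
      by (intro shift G1' ne)
  next
    fix u v :: 'a
    show "continuous_on S (\<lambda>z. of_real (G2 (z - c) u v) :: 'b)" by (rule cont)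
  next
    fix z assume "z \<in> S"
    then show "(\<Sum>u\<in>Basis. of_real (G2 (z - c) u u) :: 'b) = 0"
      using laplace[OF ne] by (simp flip: of_real_sum)
  qed
qed

lemma norm_kelvin_plane_power_le:
  assumes e: "e1 \<in> Basis" "e2 \<in> Basis" "e1 \<noteq> e2" and z: "(z :: 'a::euclidean_space) \<noteq> 0"
  shows "\<bar>kelvin_plane_power m e1 e2 z\<bar> \<le> norm z powr (- (real m + real DIM('a) - 2))"
proof -
  have "\<bar>Re (plane_coord e1 e2 z ^ m)\<bar> \<le> norm (plane_coord e1 e2 z ^ m)" by (rule abs_Re_le_cmod)
  also have "\<dots> \<le> norm z ^ m" using norm_plane_coord_le[OF e] by (simp add: norm_power power_mono)
  also have "\<dots> = norm z powr real m" using z by (simp add: powr_realpow)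
  finally have "\<bar>kelvin_plane_power m e1 e2 z\<bar> \<le> norm z powr real m * (z \<bullet> z) powr (1 - real m - real DIM('a) / 2)"
    unfolding kelvin_plane_power_def abs_mult by (intro mult_mono) auto
  also have "z \<bullet> z = norm z powr 2" using z by (simp add: power2_norm_eq_inner)
  also have "norm z powr real m * (norm z powr 2) powr (1 - real m - real DIM('a) / 2) = norm z powr (- (real m + real DIM('a) - 2))"
    unfolding powr_powr powr_add[symmetric] by (simp add: algebra_simps)
  finally show ?thesis .
qed


text \<open>Test functions for a cube of centre \<open>(\<xi>, \<eta>)\<close>.  The pole is put at \<open>(\<xi>, - K * \<eta>)\<close> below it.  The
  function \<open>kelvin_plane_power\<close> has zeros, but only away from the vertical axis \<open>e1\<close>: seen from a pole so deep
  (\<open>K\<close> large), the cube lies in a narrow cone about that axis, where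
  \<open>Re (plane_coord e1 e2 w ^ m)\<close> is at least half of the value that it takes on the axis at the same height.\<close>
lemma ex_peaked_harmonic:
  fixes M :: real
  obtains N c where "M < N" "0 < c"
    "\<And>(\<xi> :: 'a::euclidean_space) \<eta>. 0 < \<eta> \<Longrightarrow>
       \<exists>g :: 'a \<times> real \<Rightarrow> 'b::real_normed_field. harmonic_on g upper_half \<and>
         (\<forall>x t. 0 < t \<longrightarrow> norm (g (x, t)) \<le> max (norm (x - \<xi>)) (max t \<eta>) powr (- N)) \<and>
         (\<forall>z\<in>cube (\<xi>, \<eta>) \<eta>. c * \<eta> powr (- N) \<le> norm (g z))"
proof -
  let ?n = "real DIM('a)"
  obtain m :: nat where m: "M < real m" using reals_Archimedean2 by blast
  define N where "N = real m + ?n - 1"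
  have n1: "1 \<le> ?n" using DIM_positive[where 'a='a] by linarith
  have MN: "M < N" and N0: "0 \<le> N" using m n1 unfolding N_def by linarith+
  obtain b where b: "b \<in> (Basis :: 'a set)" using nonempty_Basis by blast
  define e1 e2 :: "'a \<times> real" where "e1 = (0, 1)" and "e2 = (b, 0)"
  have e: "e1 \<in> Basis" "e2 \<in> Basis" "e1 \<noteq> e2" using b by (auto simp: e1_def e2_def Basis_prod_def)
  have "continuous_on UNIV (\<lambda>s. Re ((1 + \<i> * complex_of_real s) ^ m))" by (intro continuous_intros)
  then have "\<exists>d>0. \<forall>s\<in>UNIV. dist s 0 < d \<longrightarrow>
      dist (Re ((1 + \<i> * complex_of_real s) ^ m)) (Re ((1 + \<i> * complex_of_real 0) ^ m)) < 1 / 2"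
    unfolding continuous_on_iff by (elim ballE[of _ _ 0] allE[of _ "1/2"]) simp_all
  then obtain d where d: "0 < d" and d': "\<And>s. \<bar>s\<bar> < d \<Longrightarrow> \<bar>Re ((1 + \<i> * complex_of_real s) ^ m) - 1\<bar> < 1 / 2"
    by (auto simp: dist_real_def)
  define K where "K = 1 + 1 / d"
  have K: "1 \<le> K" "1 / K < d" using d by (auto simp: K_def field_simps)
  define \<kappa> where "\<kappa> = 1 - real m - (?n + 1) / 2"
  have "1 - x - (y + 1) / 2 \<le> 0" if "0 \<le> x" "1 \<le> y" for x y :: real using that by (simp add: field_simps)
  then have \<kappa>: "\<kappa> \<le> 0" unfolding \<kappa>_def using n1 of_nat_0_le_iff by blast
  define Lc where "Lc = ?n + K + 2"
  define c where "c = K ^ m / 2 * Lc powr (2 * \<kappa>)"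
  have Lc: "0 < Lc" using K n1 unfolding Lc_def by linarith
  show ?thesis
  proof (rule that[OF MN])
    show "0 < c" using K Lc by (simp add: c_def)
    fix \<xi> :: 'a and \<eta> :: real assume \<eta>: "0 < \<eta>"
    define g :: "'a \<times> real \<Rightarrow> 'b" where "g z = of_real (kelvin_plane_power m e1 e2 (z - (\<xi>, - K * \<eta>)))" for z
    have "harmonic_on g upper_half"
      unfolding g_def
    proof (rule harmonic_on_kelvin_plane_power[OF open_upper_half _ e])
      have "0 < K * \<eta>" using K \<eta> by simp
      then show "(\<xi>, - K * \<eta>) \<notin> upper_half" by (simp add: upper_half_def)
    qed
    moreover have "norm (g (x, t)) \<le> max (norm (x - \<xi>)) (max t \<eta>) powr (- N)" if t: "0 < t" for x t
    proof -
      let ?w = "(x, t) - (\<xi>, - K * \<eta>)"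
      have \<eta>K: "\<eta> \<le> K * \<eta>" using K \<eta> by simp
      have "norm (x - \<xi>) \<le> norm ?w" using norm_fst_le[of "x - \<xi>" "t + K * \<eta>"] by simp
      moreover have "t + K * \<eta> \<le> norm ?w" using norm_snd_le[of "t + K * \<eta>" "x - \<xi>"] by simp
      ultimately have le: "max (norm (x - \<xi>)) (max t \<eta>) \<le> norm ?w"
        using t \<eta> \<eta>K by (intro max.boundedI) linarith+
      have pos: "0 < max (norm (x - \<xi>)) (max t \<eta>)" using t by (simp add: less_max_iff_disj)
      have "norm (g (x, t)) = \<bar>kelvin_plane_power m e1 e2 ?w\<bar>" by (simp add: g_def)
      also have "\<dots> \<le> norm ?w powr (- (real m + real DIM('a \<times> real) - 2))"
        using le pos by (intro norm_kelvin_plane_power_le[OF e]) (auto simp del: diff_Pair)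
      also have "\<dots> = norm ?w powr (- N)" by (simp add: N_def)
      also have "\<dots> \<le> max (norm (x - \<xi>)) (max t \<eta>) powr (- N)"
        using le pos N0 by (intro powr_mono2') auto
      finally show ?thesis .
    qed
    moreover have "c * \<eta> powr (- N) \<le> norm (g z)" if "z \<in> cube (\<xi>, \<eta>) \<eta>" for z
    proof -
      obtain x t where z: "z = (x, t)" by (cases z)
      have x: "\<bar>(x - \<xi>) \<bullet> i\<bar> \<le> \<eta>" if "i \<in> Basis" for i
        using \<open>z \<in> _\<close> that unfolding z mem_cube_Pair_iff by (simp add: mem_cube_iff)
      have t: "0 \<le> t" "t \<le> 2 * \<eta>" using \<open>z \<in> _\<close> unfolding z mem_cube_Pair_iff by linarith+
      define T where "T = t + K * \<eta>"
      define y where "y = (x - \<xi>) \<bullet> b"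
      let ?w = "z - (\<xi>, - K * \<eta>)"
      have w: "?w = (x - \<xi>, T)" by (simp add: z T_def)
      have T: "K * \<eta> \<le> T" "T \<le> (K + 2) * \<eta>" "0 < T" using t K \<eta> by (auto simp: T_def algebra_simps add_nonneg_pos)
      have "\<bar>y / T\<bar> \<le> \<eta> / (K * \<eta>)"
        unfolding abs_divide using x[OF b] T K \<eta> by (intro frac_le) (auto simp: y_def)
      also have "\<dots> < d" using K \<eta> by simp
      finally have "\<bar>Re ((1 + \<i> * complex_of_real (y / T)) ^ m) - 1\<bar> < 1 / 2" by (rule d')
      then have half: "1 / 2 \<le> Re ((1 + \<i> * complex_of_real (y / T)) ^ m)" by linarith
      have "plane_coord e1 e2 ?w = T *\<^sub>R (1 + \<i> * complex_of_real (y / T))"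
        using T unfolding w by (simp add: plane_coord_def e1_def e2_def y_def complex_eq_iff)
      then have "Re (plane_coord e1 e2 ?w ^ m) = T ^ m * Re ((1 + \<i> * complex_of_real (y / T)) ^ m)"
        by (simp add: scaleR_power)
      also have "\<dots> \<ge> T ^ m * (1 / 2)" using half T by (intro mult_left_mono) auto
      also have "T ^ m * (1 / 2) \<ge> (K * \<eta>) ^ m * (1 / 2)" using T K \<eta> by (intro mult_right_mono power_mono) auto
      finally have lower: "(K * \<eta>) ^ m / 2 \<le> Re (plane_coord e1 e2 ?w ^ m)" by simp
      have "norm (x - \<xi>) \<le> (\<Sum>i\<in>Basis. \<bar>(x - \<xi>) \<bullet> i\<bar>)" by (rule norm_le_l1)
      also have "\<dots> \<le> (\<Sum>i\<in>(Basis :: 'a set). \<eta>)" by (intro sum_mono x)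
      also have "\<dots> = ?n * \<eta>" by simp
      finally have "norm ?w \<le> ?n * \<eta> + (K + 2) * \<eta>"
        using T norm_Pair_le[of "x - \<xi>" T] unfolding w by simp
      then have upper: "norm ?w \<le> Lc * \<eta>" by (simp add: Lc_def algebra_simps)
      have w0: "0 < norm ?w" using T unfolding w by (simp add: zero_prod_def)
      have "(Lc * \<eta>) powr (2 * \<kappa>) \<le> norm ?w powr (2 * \<kappa>)"
        using upper w0 \<kappa> by (intro powr_mono2') auto
      also have "\<dots> = (norm ?w powr 2) powr \<kappa>" by (simp only: powr_powr)
      also have "norm ?w powr 2 = ?w \<bullet> ?w" using w0 by (simp add: power2_norm_eq_inner)
      finally have "(K * \<eta>) ^ m / 2 * (Lc * \<eta>) powr (2 * \<kappa>) \<le> Re (plane_coord e1 e2 ?w ^ m) * (?w \<bullet> ?w) powr \<kappa>"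
        using lower order_trans[OF _ lower, of 0] K \<eta> by (intro mult_mono) simp_all
      also have "\<dots> = kelvin_plane_power m e1 e2 ?w" by (simp add: kelvin_plane_power_def \<kappa>_def add.commute)
      also have "\<dots> \<le> norm (g z)" by (simp add: g_def)
      also have "(K * \<eta>) ^ m / 2 * (Lc * \<eta>) powr (2 * \<kappa>) = c * (\<eta> powr real m * \<eta> powr (2 * \<kappa>))"
        using Lc \<eta> by (simp add: c_def powr_mult powr_realpow power_mult_distrib)
      also have "\<eta> powr real m * \<eta> powr (2 * \<kappa>) = \<eta> powr (- N)"
      proof -
        have "real m + 2 * \<kappa> = - N" by (simp add: N_def \<kappa>_def algebra_simps add_divide_distrib)
        then show ?thesis by (simp flip: powr_add)
      qed
      finally show ?thesis .
    qed
    ultimately show "\<exists>g :: 'a \<times> real \<Rightarrow> 'b. harmonic_on g upper_half \<and>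
         (\<forall>x t. 0 < t \<longrightarrow> norm (g (x, t)) \<le> max (norm (x - \<xi>)) (max t \<eta>) powr (- N)) \<and>
         (\<forall>z\<in>cube (\<xi>, \<eta>) \<eta>. c * \<eta> powr (- N) \<le> norm (g z))"
      by blast
  qed
qed


text \<open>Testing the embedding on the peaked functions.  The exponent \<open>N\<close> has to exceed \<open>\<alpha> + n / p\<close>: then the
  \<open>p\<close>-th power of the decay is integrable in \<open>x\<close>, and the resulting exponent \<open>Q\<close> in \<open>t\<close> beats the
  weight.  The norm of the test function is at most of order \<open>\<eta> powr (\<alpha> + n / p - N)\<close> and its values on the cube are
  at least of order \<open>\<eta> powr (- N)\<close>.\<close>
lemma embedding_imp_carleson_condition:
  fixes p q \<alpha> :: real and \<xi> :: "nat \<Rightarrow> 'a::euclidean_space" and \<mu> :: "('a \<times> real) measure"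
  assumes p: "0 < p" and pq: "p \<le> q" and \<alpha>: "0 < \<alpha>"
    and W: "whitney_decomposition \<xi> \<eta> r"
    and sets: "sets \<mu> = sets (restrict_space borel upper_half)"
    and emb: "continuous_embedding (B_space q p \<alpha> :: ('a \<times> real \<Rightarrow> 'b::real_normed_field) set)
           (B_norm q p \<alpha>) (Lp_space q \<mu>) (Lp_norm q \<mu>)"
  shows "\<exists>C\<ge>0. \<forall>k. emeasure \<mu> (cube (\<xi> k, \<eta> k) (r k)) \<le> ennreal (C * \<eta> k powr (real DIM('a) * (q / p) + \<alpha> * q))"
proof -
  let ?m = "q / p" and ?n = "real DIM('a)"
  have m: "1 \<le> ?m" and q: "0 < q" using p pq by auto
  obtain N c where N: "\<alpha> + ?n / p < N" and c: "0 < c" and peak: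
    "\<And>(\<xi> :: 'a) \<eta>. 0 < \<eta> \<Longrightarrow>
       \<exists>g :: 'a \<times> real \<Rightarrow> 'b. harmonic_on g upper_half \<and>
         (\<forall>x t. 0 < t \<longrightarrow> norm (g (x, t)) \<le> max (norm (x - \<xi>)) (max t \<eta>) powr (- N)) \<and>
         (\<forall>z\<in>cube (\<xi>, \<eta>) \<eta>. c * \<eta> powr (- N) \<le> norm (g z))"
    using ex_peaked_harmonic[of "\<alpha> + ?n / p", where 'a='a and 'b='b] by blast
  define P where "P = N * p"
  define Q where "Q = (P - ?n) * ?m"
  have "?n / p < N" using N \<alpha> by simp
  then have P: "?n < P" using p by (simp add: P_def field_simps)
  have Q_eq: "Q = N * q - ?n * ?m" using p by (simp add: Q_def P_def field_simps)
  have "(\<alpha> + ?n / p) * q < N * q" using N q by (rule mult_strict_right_mono)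
  then have Q: "\<alpha> * q < Q" by (simp add: Q_eq algebra_simps)
  have \<alpha>q: "0 < \<alpha> * q" using \<alpha> q by simp
  obtain C1 where C1: "0 < C1" and slice:
    "\<And>(\<xi> :: 'a) \<tau>. 0 < \<tau> \<Longrightarrow> (\<integral>\<^sup>+x. ennreal (max (norm (x - \<xi>)) \<tau> powr (- P)) \<partial>lborel) \<le> ennreal (C1 * \<tau> powr (?n - P))"
    using nn_integral_max_norm_powr_le[OF P] by blast
  obtain C2 where C2: "0 < C2" and outer:
    "\<And>\<eta>. 0 < \<eta> \<Longrightarrow> (\<integral>\<^sup>+t\<in>{0<..}. ennreal (max t \<eta> powr (- Q)) * ennreal (t powr (\<alpha> * q - 1)) \<partial>lborel) \<le> ennreal (C2 * \<eta> powr (\<alpha> * q - Q))"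
    using nn_integral_max_powr_le[OF \<alpha>q Q] by blast
  obtain C0 :: real where C0: "0 \<le> C0" and emb_le:
    "\<And>f. f \<in> (B_space q p \<alpha> :: ('a \<times> real \<Rightarrow> 'b) set) \<Longrightarrow> Lp_norm q \<mu> f \<le> ennreal C0 * B_norm q p \<alpha> f"
    using emb unfolding continuous_embedding_def by blast
  have r: "r k \<le> \<eta> k" "0 < \<eta> k" for k
    using whitney_side_comparable[OF W] by (metis, metis less_le_trans)
  define C where "C = C0 powr q * (C1 powr ?m * C2) / c powr q"
  have "emeasure \<mu> (cube (\<xi> k, \<eta> k) (r k)) \<le> ennreal (C * \<eta> k powr (?n * ?m + \<alpha> * q))" for k
  proof -
    let ?\<eta> = "\<eta> k" and ?Q = "cube (\<xi> k, \<eta> k) (r k)"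
    obtain g :: "'a \<times> real \<Rightarrow> 'b" where g: "harmonic_on g upper_half"
      and g_le: "\<And>x t. 0 < t \<Longrightarrow> norm (g (x, t)) \<le> max (norm (x - \<xi> k)) (max t ?\<eta>) powr (- N)"
      and g_ge: "\<And>z. z \<in> cube (\<xi> k, ?\<eta>) ?\<eta> \<Longrightarrow> c * ?\<eta> powr (- N) \<le> norm (g z)"
      using peak[OF r(2)[of k], of "\<xi> k"] by blast
    define J where "J = (\<integral>\<^sup>+t\<in>{0<..}. ennpowr (slice_norm p g t) q * ennreal (t powr (\<alpha> * q - 1)) \<partial>lborel)"
    have slice_le: "ennpowr (slice_norm p g t) q \<le> ennreal (C1 powr ?m) * ennreal (max t ?\<eta> powr (- Q))" if t: "0 < t" for t
    proof -
      have "norm (g (x, t)) powr p \<le> max (norm (x - \<xi> k)) (max t ?\<eta>) powr (- P)" for x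
      proof -
        have "norm (g (x, t)) powr p \<le> (max (norm (x - \<xi> k)) (max t ?\<eta>) powr (- N)) powr p"
          using g_le[OF t] p by (intro powr_mono2) auto
        then show ?thesis by (simp add: powr_powr P_def)
      qed
      then have "(\<integral>\<^sup>+x. ennreal (norm (g (x, t)) powr p) \<partial>lborel) \<le> (\<integral>\<^sup>+x. ennreal (max (norm (x - \<xi> k)) (max t ?\<eta>) powr (- P)) \<partial>lborel)"
        by (intro nn_integral_mono ennreal_leI)
      also have "\<dots> \<le> ennreal (C1 * max t ?\<eta> powr (?n - P))" using t by (intro slice) simp
      finally have "ennpowr (slice_norm p g t) q \<le> ennpowr (ennreal (C1 * max t ?\<eta> powr (?n - P))) ?m"
        unfolding ennpowr_slice_norm[OF p] using m by (intro ennpowr_mono) auto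
      also have "\<dots> = ennreal (C1 powr ?m * max t ?\<eta> powr (- Q))"
      proof -
        have "(?n - P) * ?m = - Q" by (simp add: Q_def algebra_simps)
        then show ?thesis using C1 by (simp only: ennpowr_ennreal powr_mult powr_powr powr_ge_zero mult_nonneg_nonneg less_imp_le)
      qed
      finally show ?thesis by (simp add: ennreal_mult)
    qed
    have "J \<le> (\<integral>\<^sup>+t. ennreal (C1 powr ?m) * (ennreal (max t ?\<eta> powr (- Q)) * ennreal (t powr (\<alpha> * q - 1)) * indicator {0<..} t) \<partial>lborel)"
      unfolding J_def
      by (intro nn_integral_mono) (auto simp: slice_le mult_right_mono simp flip: mult.assoc split: split_indicator)
    also have "\<dots> = ennreal (C1 powr ?m) * (\<integral>\<^sup>+t\<in>{0<..}. ennreal (max t ?\<eta> powr (- Q)) * ennreal (t powr (\<alpha> * q - 1)) \<partial>lborel)"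
      by (rule nn_integral_cmult) measurable
    also have "\<dots> \<le> ennreal (C1 powr ?m) * ennreal (C2 * ?\<eta> powr (\<alpha> * q - Q))"
      by (intro mult_left_mono outer r) simp
    also have "\<dots> = ennreal (C1 powr ?m * C2 * ?\<eta> powr (\<alpha> * q - Q))"
      using C2 by (simp add: mult.assoc flip: ennreal_mult)
    finally have J: "J \<le> ennreal (C1 powr ?m * C2 * ?\<eta> powr (\<alpha> * q - Q))" .
    have BJ: "B_norm q p \<alpha> g = ennpowr J (1 / q)" unfolding B_norm_def J_def ..
    have "J < top" using J by (rule le_less_trans) simp
    then have "g \<in> B_space q p \<alpha>" using g by (simp add: B_space_def BJ less_top[symmetric])
    then have "ennpowr (Lp_norm q \<mu> g) q \<le> ennpowr (ennreal C0 * ennpowr J (1 / q)) q"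
      using emb_le[of g] q by (intro ennpowr_mono) (auto simp: BJ)
    then have "(\<integral>\<^sup>+z. ennreal (norm (g z) powr q) \<partial>\<mu>) \<le> ennreal (C0 powr q) * J"
      using q C0 by (simp add: Lp_norm_def ennpowr_mult ennpowr_ennpowr ennpowr_ennreal)
    also have "\<dots> \<le> ennreal (C0 powr q) * ennreal (C1 powr ?m * C2 * ?\<eta> powr (\<alpha> * q - Q))"
      by (intro mult_left_mono J) simp
    finally have int_le: "(\<integral>\<^sup>+z. ennreal (norm (g z) powr q) \<partial>\<mu>) \<le> ennreal (C0 powr q * (C1 powr ?m * C2 * ?\<eta> powr (\<alpha> * q - Q)))"
      using C2 by (simp add: ennreal_mult)
    define A where "A = (c * ?\<eta> powr (- N)) powr q"
    have A: "0 < A" using c r(2)[of k] by (simp add: A_def)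
    have "ennreal A * emeasure \<mu> ?Q = (\<integral>\<^sup>+z. ennreal A * indicator ?Q z \<partial>\<mu>)"
      using cube_in_sets_upper_half[OF W sets] by (rule nn_integral_cmult_indicator[symmetric])
    also have "\<dots> \<le> (\<integral>\<^sup>+z. ennreal (norm (g z) powr q) \<partial>\<mu>)"
    proof (rule nn_integral_mono)
      fix z
      have "A \<le> norm (g z) powr q" if "z \<in> ?Q"
        unfolding A_def using that cube_mono[OF r(1)[of k]] c q by (intro powr_mono2 g_ge) auto
      then show "ennreal A * indicator ?Q z \<le> ennreal (norm (g z) powr q)"
        by (auto intro!: ennreal_leI split: split_indicator)
    qed
    also note int_le
    finally have le: "ennreal A * emeasure \<mu> ?Q \<le> ennreal (C0 powr q * (C1 powr ?m * C2 * ?\<eta> powr (\<alpha> * q - Q)))" .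
    have "emeasure \<mu> ?Q = ennreal (1 / A) * (ennreal A * emeasure \<mu> ?Q)"
      using A by (simp flip: mult.assoc ennreal_mult)
    also have "\<dots> \<le> ennreal (1 / A) * ennreal (C0 powr q * (C1 powr ?m * C2 * ?\<eta> powr (\<alpha> * q - Q)))"
      by (intro mult_left_mono le) simp
    also have "\<dots> = ennreal (C0 powr q * (C1 powr ?m * C2 * ?\<eta> powr (\<alpha> * q - Q)) / A)"
      using A C2 by (simp flip: ennreal_mult)
    also have "C0 powr q * (C1 powr ?m * C2 * ?\<eta> powr (\<alpha> * q - Q)) / A = C * ?\<eta> powr (?n * ?m + \<alpha> * q)"
    proof -
      have "A = c powr q * ?\<eta> powr (- (N * q))"
        using c by (simp add: A_def powr_mult powr_powr)
      moreover have "?\<eta> powr (?n * ?m + \<alpha> * q) = ?\<eta> powr (\<alpha> * q - Q) / ?\<eta> powr (- (N * q))"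
        unfolding powr_diff[symmetric] by (simp add: Q_eq algebra_simps)
      ultimately show ?thesis by (simp add: C_def)
    qed
    finally show ?thesis .
  qed
  moreover have "0 \<le> C" using C2 by (simp add: C_def)
  ultimately show ?thesis by blast
qed

section \<open>The embedding theorem\<close>

theorem theorem3:
  fixes p q \<alpha> :: real
    and \<xi> :: "nat \<Rightarrow> real ^ 'n"
    and \<eta> r :: "nat \<Rightarrow> real"
    and \<mu> :: "((real ^ 'n) \<times> real) measure"
  assumes "0 < p" and "p \<le> q" and "0 < \<alpha>"
    and "whitney_decomposition \<xi> \<eta> r"
    and "sets \<mu> = sets (restrict_space borel upper_half)"
  shows "(\<exists>C::real. 0 \<le> C \<and>
            (\<forall>k. emeasure \<mu> (cube (\<xi> k, \<eta> k) (r k))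
                  \<le> ennreal (C * \<eta> k powr (real CARD('n) * (q / p) + \<alpha> * q))))
     \<longleftrightarrow>
         continuous_embedding
           (B_space q p \<alpha> :: ((real ^ 'n) \<times> real \<Rightarrow> 'b::{real_normed_field, euclidean_space}) set)
           (B_norm q p \<alpha>) (Lp_space q \<mu>) (Lp_norm q \<mu>)"
  using carleson_condition_imp_embedding[OF assms(1,2,4,5), where \<alpha>=\<alpha> and 'b='b]
    embedding_imp_carleson_condition[OF assms, where 'b='b] by auto

end
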